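(* Let $G\in\{SU(2),\widetilde{E}_2,\widetilde{SL}_2\}$, let $\Gamma\subset G$ be a discrete subgroup, let $\alpha=(\alpha^1,\alpha^2,\alpha^3)$ be a $\mathcal{K}$-Cartan structure on $G/\Gamma$, and let $\varphi=I\alpha^1+J\alpha^2$ be a 1-form on $G$ (the $\alpha^i$ and $\mathcal{K}$ being lifted to $G$) such that 1. $\varphi$ is $\Gamma$-invariant, and 2. $d\varphi=(\mathcal{K}-1)\,\alpha^1\wedge\alpha^2$, with non-constant coefficients $I,J$. Then the coframe $$\omega^1=\alpha^1,\qquad \omega^2=\varphi-\alpha^3,\qquad \omega^3=\alpha^2$$ is an $(I,J,1)$-generalized Finsler structure on $\Sigma=G/\Gamma$.
   Context: $\widetilde{E}_2$ is the universal cover of the group of orientation preserving isometries of $\mathbb{R}^2$; $\widetilde{SL}_2$ is the universal cover of $PSL_2(\mathbb{R})$. $G/\Gamma$ denotes the quotient of $G$ by the action of $\Gamma$ by left multiplication. A $\mathcal{K}$-Cartan structure on a 3-manifold is a coframe $(\alpha^1,\alpha^2,\alpha^3)$ with $d\alpha^1=\alpha^2\wedge\alpha^3$, $d\alpha^2=\alpha^3\wedge\alpha^1$, $d\alpha^3=\mathcal{K}\,\alpha^1\wedge\alpha^2$, where $\mathcal{K}$ is a smooth function (not necessarily constant). An $(I,J,1)$-generalized Finsler structure on $\Sigma$ is a coframe $(\omega^1,\omega^2,\omega^3)$ with $$d\omega^1=-I\,\omega^1\wedge\omega^3+\omega^2\wedge\omega^3,\quad d\omega^2=-\omega^1\wedge\omega^3,\quad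 d\omega^3=\omega^1\wedge\omega^2-J\,\omega^1\wedge\omega^3,$$ with $I,J$ smooth functions on $\Sigma$. *)

theory Defs
  imports "HOL-Analysis.Analysis" "HOL-Algebra.Coset"
begin

section \<open>Smooth maps between open subsets of Euclidean spaces\<close>

(* Intended for open S.  C^(n+1) means: differentiable on S with all directional derivatives C^n. *)
primrec C_k :: "nat \<Rightarrow> 'a::real_normed_vector set \<Rightarrow> ('a \<Rightarrow> 'b::real_normed_vector) \<Rightarrow> bool" where
  "C_k 0 S f \<longleftrightarrow> continuous_on S f"
| "C_k (Suc n) S f \<longleftrightarrow>
     (\<forall>x\<in>S. f differentiable (at x)) \<and> (\<forall>v. C_k n S (\<lambda>x. frechet_derivative f (at x) v))"

definition smooth_on :: "'a::real_normed_vector set \<Rightarrow> ('a \<Rightarrow> 'b::real_normed_vector) \<Rightarrow> bool" where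
  "smooth_on S f \<longleftrightarrow> (\<forall>n. C_k n S f)"


section \<open>Smooth manifolds\<close>

(* A manifold is given by its atlas alone: a set of charts (U, h), where only the values of h on U
   matter.  The underlying set is the union of the chart domains, and the topology is the one
   for which all charts are homeomorphisms onto open subsets of the model space 'e. *)
type_synonym ('a, 'e) atlas = "('a set \<times> ('a \<Rightarrow> 'e)) set"

definition points :: "('a, 'e) atlas \<Rightarrow> 'a set" where
  "points A = (\<Union>(U, h)\<in>A. U)"

definition atlas_topology :: "('a, 'e::euclidean_space) atlas \<Rightarrow> 'a topology" where
  "atlas_topology A = topology (\<lambda>W. W \<subseteq> points A \<and> (\<forall>(U, h)\<in>A. open (h ` (W \<inter> U))))"

definition smooth_manifold :: "('a, 'e::euclidean_space) atlas \<Rightarrow> bool" where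
  "smooth_manifold A \<longleftrightarrow>
     (\<forall>(U, h)\<in>A. inj_on h U \<and> open (h ` U)) \<and>
     (\<forall>(U, h)\<in>A. \<forall>(V, k)\<in>A. open (h ` (U \<inter> V)) \<and> smooth_on (h ` (U \<inter> V)) (k \<circ> inv_into U h)) \<and>
     Hausdorff_space (atlas_topology A) \<and> second_countable (atlas_topology A)"

definition smooth_map ::
  "('a, 'd::euclidean_space) atlas \<Rightarrow> ('b, 'e::euclidean_space) atlas \<Rightarrow> ('a \<Rightarrow> 'b) \<Rightarrow> bool" where
  "smooth_map A B F \<longleftrightarrow>
     continuous_map (atlas_topology A) (atlas_topology B) F \<and>
     (\<forall>(U, h)\<in>A. \<forall>(V, k)\<in>B. smooth_on (h ` {x \<in> U. F x \<in> V}) (k \<circ> F \<circ> inv_into U h))"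

definition smooth_function :: "('a, 'e::euclidean_space) atlas \<Rightarrow> ('a \<Rightarrow> real) \<Rightarrow> bool" where
  "smooth_function A f \<longleftrightarrow> (\<forall>(U, h)\<in>A. smooth_on (h ` U) (f \<circ> inv_into U h))"

definition diffeomorphism ::
  "('a, 'd::euclidean_space) atlas \<Rightarrow> ('b, 'e::euclidean_space) atlas \<Rightarrow> ('a \<Rightarrow> 'b) \<Rightarrow> bool" where
  "diffeomorphism A B F \<longleftrightarrow>
     (\<exists>F'. smooth_map A B F \<and> smooth_map B A F' \<and>
        (\<forall>x\<in>points A. F' (F x) = x) \<and> (\<forall>y\<in>points B. F (F' y) = y))"

definition restrict_atlas :: "('a, 'e) atlas \<Rightarrow> 'a set \<Rightarrow> ('a, 'e) atlas" where
  "restrict_atlas A W = (\<lambda>(U, h). (U \<inter> W, h)) ` A"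

definition prod_atlas :: "('a, 'd) atlas \<Rightarrow> ('b, 'e) atlas \<Rightarrow> ('a \<times> 'b, 'd \<times> 'e) atlas" where
  "prod_atlas A B = {(U \<times> V, map_prod h k) | U h V k. (U, h) \<in> A \<and> (V, k) \<in> B}"

(* The smooth structure on S induced by an injection e of S into a Euclidean space whose image
   is an embedded submanifold: the charts are the inverses of the regular parametrizations. *)
definition embedded_atlas ::
  "('a \<Rightarrow> 'b::euclidean_space) \<Rightarrow> 'a set \<Rightarrow> ('a, 'e::euclidean_space) atlas" where
  "embedded_atlas e S = {(U, h).
     U \<subseteq> S \<and> openin (top_of_set (e ` S)) (e ` U) \<and>
     inj_on h U \<and> open (h ` U) \<and>
     smooth_on (h ` U) (e \<circ> inv_into U h) \<and>
     (\<forall>x\<in>h ` U. inj (frechet_derivative (e \<circ> inv_into U h) (at x))) \<and>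
     continuous_on (e ` U) (h \<circ> inv_into S e)}"

(* The smooth structure on the image of a projection q that is locally injective, open and
   compatible with A, such as the orbit projection of a properly discontinuous free action:
   the charts are those of A on open sets W where q is injective, transported along q. *)
definition quotient_atlas :: "('a, 'e::euclidean_space) atlas \<Rightarrow> ('a \<Rightarrow> 'b) \<Rightarrow> ('b, 'e) atlas" where
  "quotient_atlas A q = {(q ` W, h \<circ> inv_into W q) | W U h.
     (U, h) \<in> A \<and> W \<subseteq> U \<and> openin (atlas_topology A) W \<and> inj_on q W}"

definition smooth_covering ::
  "('a, 'd::euclidean_space) atlas \<Rightarrow> ('b, 'e::euclidean_space) atlas \<Rightarrow> ('a \<Rightarrow> 'b) \<Rightarrow> bool" where
  "smooth_covering A B p \<longleftrightarrow>
     smooth_map A B p \<and> p ` points A = points B \<and>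
     (\<forall>y\<in>points B. \<exists>T. y \<in> T \<and> openin (atlas_topology B) T \<and>
        (\<exists>\<V>. \<Union>\<V> = {x \<in> points A. p x \<in> T} \<and> pairwise disjnt \<V> \<and>
           (\<forall>V\<in>\<V>. openin (atlas_topology A) V \<and>
              diffeomorphism (restrict_atlas A V) (restrict_atlas B T) p)))"

(* The library's simply_connected, for abstract topologies; it includes path-connectedness. *)
definition simply_connected_space :: "'a topology \<Rightarrow> bool" where
  "simply_connected_space X \<longleftrightarrow>
     (\<forall>p q. pathin X p \<and> p 1 = p 0 \<and> pathin X q \<and> q 1 = q 0 \<longrightarrow>
        homotopic_with (\<lambda>r. r 1 = r 0) (top_of_set {0..1}) X p q)"


section \<open>Tangent vectors and differential forms\<close>

(* Functions smooth near p.  Two of them that agree near p are not identified, but a derivation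
   at p cannot distinguish them (apply the Leibniz rule to their difference times the indicator
   function of a small neighbourhood), so tangent_space is the space of derivations of germs. *)
definition smooth_near :: "('a, 'e::euclidean_space) atlas \<Rightarrow> 'a \<Rightarrow> ('a \<Rightarrow> real) set" where
  "smooth_near A p = {f. \<exists>W. p \<in> W \<and> openin (atlas_topology A) W \<and>
     (\<forall>(U, h)\<in>A. smooth_on (h ` (U \<inter> W)) (f \<circ> inv_into U h))}"

type_synonym 'a tangent = "('a \<Rightarrow> real) \<Rightarrow> real"

(* The value 0 on functions that are not smooth near p makes the representation unique. *)
definition tangent_space :: "('a, 'e::euclidean_space) atlas \<Rightarrow> 'a \<Rightarrow> 'a tangent set" where
  "tangent_space A p = {v.
     (\<forall>f\<in>smooth_near A p. \<forall>g\<in>smooth_near A p. v (\<lambda>x. f x + g x) = v f + v g) \<and>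
     (\<forall>c. \<forall>f\<in>smooth_near A p. v (\<lambda>x. c * f x) = c * v f) \<and>
     (\<forall>f\<in>smooth_near A p. \<forall>g\<in>smooth_near A p. v (\<lambda>x. f x * g x) = v f * g p + f p * v g) \<and>
     (\<forall>f. f \<notin> smooth_near A p \<longrightarrow> v f = 0)}"

(* The partial derivative at p in direction b of the chart (U, h). *)
definition coord_vector ::
  "('a, 'e::euclidean_space) atlas \<Rightarrow> 'a set \<Rightarrow> ('a \<Rightarrow> 'e) \<Rightarrow> 'e \<Rightarrow> 'a \<Rightarrow> 'a tangent" where
  "coord_vector A U h b p =
     (\<lambda>f. if f \<in> smooth_near A p then frechet_derivative (f \<circ> inv_into U h) (at (h p)) b else 0)"

definition push_forward ::
  "('a, 'd::euclidean_space) atlas \<Rightarrow> ('b, 'e::euclidean_space) atlas \<Rightarrow> ('a \<Rightarrow> 'b) \<Rightarrow>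
     'a \<Rightarrow> 'a tangent \<Rightarrow> 'b tangent" where
  "push_forward A B F p v = (\<lambda>f. if f \<in> smooth_near B (F p) then v (f \<circ> F) else 0)"

(* Only the values on points p of the manifold and on tangent vectors at p matter. *)
type_synonym 'a form1 = "'a \<Rightarrow> 'a tangent \<Rightarrow> real"
type_synonym 'a form2 = "'a \<Rightarrow> 'a tangent \<Rightarrow> 'a tangent \<Rightarrow> real"

definition covector ::
  "('a, 'e::euclidean_space) atlas \<Rightarrow> 'a \<Rightarrow> ('a tangent \<Rightarrow> real) \<Rightarrow> bool" where
  "covector A p l \<longleftrightarrow>
     (\<forall>u\<in>tangent_space A p. \<forall>v\<in>tangent_space A p. l (\<lambda>f. u f + v f) = l u + l v) \<and>
     (\<forall>c. \<forall>v\<in>tangent_space A p. l (\<lambda>f. c * v f) = c * l v)"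

definition form_component ::
  "('a, 'e::euclidean_space) atlas \<Rightarrow> 'a set \<Rightarrow> ('a \<Rightarrow> 'e) \<Rightarrow> 'a form1 \<Rightarrow> 'e \<Rightarrow> 'e \<Rightarrow> real" where
  "form_component A U h \<omega> b x =
     \<omega> (inv_into U h x) (coord_vector A U h b (inv_into U h x))"

definition smooth_form1 :: "('a, 'e::euclidean_space) atlas \<Rightarrow> 'a form1 \<Rightarrow> bool" where
  "smooth_form1 A \<omega> \<longleftrightarrow>
     (\<forall>p\<in>points A. covector A p (\<omega> p)) \<and>
     (\<forall>(U, h)\<in>A. \<forall>b\<in>Basis. smooth_on (h ` U) (form_component A U h \<omega> b))"

definition wedge :: "'a form1 \<Rightarrow> 'a form1 \<Rightarrow> 'a form2" where
  "wedge \<alpha> \<beta> p u v = \<alpha> p u * \<beta> p v - \<alpha> p v * \<beta> p u"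

definition pullback ::
  "('a, 'd::euclidean_space) atlas \<Rightarrow> ('b, 'e::euclidean_space) atlas \<Rightarrow> ('a \<Rightarrow> 'b) \<Rightarrow>
     'b form1 \<Rightarrow> 'a form1" where
  "pullback A B F \<omega> p v = \<omega> (F p) (push_forward A B F p v)"

definition form1_eq :: "('a, 'e::euclidean_space) atlas \<Rightarrow> 'a form1 \<Rightarrow> 'a form1 \<Rightarrow> bool" where
  "form1_eq A \<alpha> \<beta> \<longleftrightarrow> (\<forall>p\<in>points A. \<forall>v\<in>tangent_space A p. \<alpha> p v = \<beta> p v)"

(* The 2-form \<eta> is d\<omega>: in every chart, its (a,b) component is the derivative of \<omega>_b along a
   minus the derivative of \<omega>_a along b.  No factor 1/2, in accordance with wedge. *)
definition has_exterior_derivative ::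
  "('a, 'e::euclidean_space) atlas \<Rightarrow> 'a form1 \<Rightarrow> 'a form2 \<Rightarrow> bool" where
  "has_exterior_derivative A \<omega> \<eta> \<longleftrightarrow>
     (\<forall>(U, h)\<in>A. \<forall>p\<in>U. \<forall>a\<in>Basis. \<forall>b\<in>Basis.
        frechet_derivative (form_component A U h \<omega> b) (at (h p)) a
        - frechet_derivative (form_component A U h \<omega> a) (at (h p)) b
        = \<eta> p (coord_vector A U h a p) (coord_vector A U h b p))"

definition coframe ::
  "('a, real ^ 3) atlas \<Rightarrow> 'a form1 \<Rightarrow> 'a form1 \<Rightarrow> 'a form1 \<Rightarrow> bool" where
  "coframe A \<omega>1 \<omega>2 \<omega>3 \<longleftrightarrow>
     smooth_form1 A \<omega>1 \<and> smooth_form1 A \<omega>2 \<and> smooth_form1 A \<omega>3 \<and>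
     (\<forall>p\<in>points A.
        (\<forall>a b c. (\<forall>v\<in>tangent_space A p. a * \<omega>1 p v + b * \<omega>2 p v + c * \<omega>3 p v = 0)
           \<longrightarrow> a = 0 \<and> b = 0 \<and> c = 0) \<and>
        (\<forall>l. covector A p l \<longrightarrow>
           (\<exists>a b c. \<forall>v\<in>tangent_space A p. l v = a * \<omega>1 p v + b * \<omega>2 p v + c * \<omega>3 p v)))"

definition cartan_structure ::
  "('a, real ^ 3) atlas \<Rightarrow> ('a \<Rightarrow> real) \<Rightarrow> 'a form1 \<Rightarrow> 'a form1 \<Rightarrow> 'a form1 \<Rightarrow> bool" where
  "cartan_structure A \<K> \<alpha>1 \<alpha>2 \<alpha>3 \<longleftrightarrow>
     smooth_function A \<K> \<and> coframe A \<alpha>1 \<alpha>2 \<alpha>3 \<and>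
     has_exterior_derivative A \<alpha>1 (wedge \<alpha>2 \<alpha>3) \<and>
     has_exterior_derivative A \<alpha>2 (wedge \<alpha>3 \<alpha>1) \<and>
     has_exterior_derivative A \<alpha>3 (\<lambda>p u v. \<K> p * wedge \<alpha>1 \<alpha>2 p u v)"

(* (I,J,1)-generalized Finsler structures. *)
definition generalized_finsler ::
  "('a, real ^ 3) atlas \<Rightarrow> ('a \<Rightarrow> real) \<Rightarrow> ('a \<Rightarrow> real) \<Rightarrow>
     'a form1 \<Rightarrow> 'a form1 \<Rightarrow> 'a form1 \<Rightarrow> bool" where
  "generalized_finsler A I J \<omega>1 \<omega>2 \<omega>3 \<longleftrightarrow>
     smooth_function A I \<and> smooth_function A J \<and> coframe A \<omega>1 \<omega>2 \<omega>3 \<and>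
     has_exterior_derivative A \<omega>1
       (\<lambda>p u v. - I p * wedge \<omega>1 \<omega>3 p u v + wedge \<omega>2 \<omega>3 p u v) \<and>
     has_exterior_derivative A \<omega>2 (\<lambda>p u v. - wedge \<omega>1 \<omega>3 p u v) \<and>
     has_exterior_derivative A \<omega>3
       (\<lambda>p u v. wedge \<omega>1 \<omega>2 p u v - J p * wedge \<omega>1 \<omega>3 p u v)"


section \<open>Lie groups\<close>

definition lie_group :: "'g monoid \<Rightarrow> ('g, 'e::euclidean_space) atlas \<Rightarrow> bool" where
  "lie_group G A \<longleftrightarrow>
     group G \<and> smooth_manifold A \<and> points A = carrier G \<and>
     smooth_map (prod_atlas A A) A (\<lambda>(x, y). x \<otimes>\<^bsub>G\<^esub> y) \<and>
     smooth_map A A (\<lambda>x. inv\<^bsub>G\<^esub> x)"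

definition lie_group_isomorphic ::
  "'g monoid \<Rightarrow> ('g, 'd::euclidean_space) atlas \<Rightarrow>
     'h monoid \<Rightarrow> ('h, 'e::euclidean_space) atlas \<Rightarrow> bool" where
  "lie_group_isomorphic G A H B \<longleftrightarrow> (\<exists>F\<in>iso G H. diffeomorphism A B F)"

(* The Lie group (G, A) is a universal covering group of (H, B); this determines it up to
   isomorphism. *)
definition universal_cover ::
  "'g monoid \<Rightarrow> ('g, 'd::euclidean_space) atlas \<Rightarrow>
     'h monoid \<Rightarrow> ('h, 'e::euclidean_space) atlas \<Rightarrow> bool" where
  "universal_cover G A H B \<longleftrightarrow>
     lie_group G A \<and> simply_connected_space (atlas_topology A) \<and>
     (\<exists>p\<in>hom G H. smooth_covering A B p)"

definition discrete_subgroup ::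
  "'g set \<Rightarrow> 'g monoid \<Rightarrow> ('g, 'e::euclidean_space) atlas \<Rightarrow> bool" where
  "discrete_subgroup \<Gamma> G A \<longleftrightarrow>
     subgroup \<Gamma> G \<and> subtopology (atlas_topology A) \<Gamma> = discrete_topology \<Gamma>"

(* The orbits of left multiplication by \<Gamma> are the right cosets of \<Gamma>. *)
definition left_quotient ::
  "'g monoid \<Rightarrow> ('g, 'e::euclidean_space) atlas \<Rightarrow> 'g set \<Rightarrow> ('g set, 'e) atlas" where
  "left_quotient G A \<Gamma> = quotient_atlas A (\<lambda>g. \<Gamma> #>\<^bsub>G\<^esub> g)"

definition SU2 :: "(complex ^ 2 ^ 2) monoid" where
  "SU2 = \<lparr>carrier = {M. M ** (\<chi> i j. cnj (M $ j $ i)) = mat 1 \<and> det M = 1},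
          mult = (**), one = mat 1\<rparr>"

definition SU2_atlas :: "(complex ^ 2 ^ 2, real ^ 3) atlas" where
  "SU2_atlas = embedded_atlas (\<lambda>M. M) (carrier SU2)"

(* An isometry f of the plane is x \<mapsto> M x + f 0 with M orthogonal; it preserves orientation
   iff det M > 0. *)
definition linear_part :: "(real ^ 2 \<Rightarrow> real ^ 2) \<Rightarrow> real ^ 2 ^ 2" where
  "linear_part f = matrix (\<lambda>x. f x - f 0)"

definition E2 :: "(real ^ 2 \<Rightarrow> real ^ 2) monoid" where
  "E2 = \<lparr>carrier = {f. (\<forall>x y. dist (f x) (f y) = dist x y) \<and> det (linear_part f) > 0},
         mult = (\<circ>), one = id\<rparr>"

definition E2_atlas :: "(real ^ 2 \<Rightarrow> real ^ 2, real ^ 3) atlas" where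
  "E2_atlas = embedded_atlas (\<lambda>f. (linear_part f, f 0)) (carrier E2)"

definition SL2 :: "(real ^ 2 ^ 2) monoid" where
  "SL2 = \<lparr>carrier = {M. det M = 1}, mult = (**), one = mat 1\<rparr>"

definition SL2_atlas :: "(real ^ 2 ^ 2, real ^ 3) atlas" where
  "SL2_atlas = embedded_atlas (\<lambda>M. M) (carrier SL2)"

definition PSL2 :: "(real ^ 2 ^ 2) set monoid" where
  "PSL2 = SL2 Mod {mat 1, - mat 1}"

definition PSL2_atlas :: "((real ^ 2 ^ 2) set, real ^ 3) atlas" where
  "PSL2_atlas = left_quotient SL2 SL2_atlas {mat 1, - mat 1}"

end

(* Left translation by an element of \<Gamma> does not change the projection \<pi>, so invariance of
   \<phi> = I \<pi>*\<alpha>1 + J \<pi>*\<alpha>2 says that (I(\<gamma> g) - I g) \<alpha>1 + (J(\<gamma> g) - J g) \<alpha>2 vanishes on the image of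
   the differential of \<pi> at g.  As \<Gamma> is discrete, \<pi> is a local diffeomorphism, so this image is the
   whole tangent space, and independence of \<alpha>1 and \<alpha>2 makes I and J invariant.  They descend
   to the quotient together with \<phi> and the equation for d\<phi>, and there the structure equations of
   the new coframe follow from those of \<alpha> by linear algebra. *)
theory Submission
  imports Defs
begin

section \<open>Calculus of smooth maps\<close>

text \<open>A tangent vector is a derivation on functions, so the projection is studied through
  composition: functions smooth near a point of the quotient are composed with the projection, and
  functions smooth near a point of the group with a local section of it. The second direction is the
  harder one. Smoothness on the quotient is tested in every chart, and the piece of the group that
  carries a chart may differ from the piece that carries the section by an element of \<Gamma>. So
  left translations must be smooth, whereas a Lie group comes only with a smooth multiplication on
  the product manifold; freezing its first factor provides them. A further obstacle is that
  derivations act on functions and not on germs, while a local section inverts the projection only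
  near the point; locality of derivations bridges this gap.\<close>

lemma C_k_cong:
  assumes "open S" "\<And>x. x \<in> S \<Longrightarrow> f x = g x" "C_k n S f"
  shows "C_k n S g"
  using assms(2,3)
proof (induction n arbitrary: f g)
  case 0
  then show ?case
    by (metis C_k.simps(1) continuous_on_cong)
next
  case (Suc n)
  \<comment> \<open>Openness of \<open>S\<close> turns agreement on \<open>S\<close> into agreement
    near each of its points, so \<open>g\<close> inherits the derivative of \<open>f\<close>, and
    the directional derivatives agree on \<open>S\<close> again.\<close>
  have g: "(g has_derivative frechet_derivative f (at x)) (at x)" if "x \<in> S" for x
  proof (rule has_derivative_transform_within_open[OF _ \<open>open S\<close> that])
    show "(f has_derivative frechet_derivative f (at x)) (at x)"
      using Suc.prems that by (simp flip: frechet_derivative_works)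
  qed (use Suc.prems in blast)
  have D: "frechet_derivative g (at x) = frechet_derivative f (at x)" if "x \<in> S" for x
    using frechet_derivative_at[OF g[OF that]] by simp
  have "C_k n S (\<lambda>x. frechet_derivative g (at x) v)" for v
    by (rule Suc.IH[of "\<lambda>x. frechet_derivative f (at x) v"]) (use Suc.prems(2) D in simp_all)
  then show ?case
    using g by (auto simp: differentiable_def)
qed

lemma C_k_subset: "C_k n S f \<Longrightarrow> T \<subseteq> S \<Longrightarrow> C_k n T f"
  by (induction n arbitrary: f) (auto intro: continuous_on_subset)

lemma C_k_SucD: "C_k (Suc n) S f \<Longrightarrow> C_k n S f"
proof (induction n arbitrary: f)
  case 0
  then show ?case
    by (auto intro!: continuous_at_imp_continuous_on differentiable_imp_continuous_within)
next
  case (Suc n)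
  then show ?case by (metis C_k.simps(2))
qed

text \<open>Serves where a formula changes from point to point: the target chart around a translated
  point, and the element of \<Gamma> relating two lifts, are chosen anew at each point.\<close>

lemma C_k_local:
  assumes "\<And>x. x \<in> S \<Longrightarrow> \<exists>T. open T \<and> x \<in> T \<and> C_k n T f"
  shows "C_k n S f"
  using assms
proof (induction n arbitrary: f)
  case 0
  then show ?case
    by (auto intro!: continuous_at_imp_continuous_on) (metis continuous_on_eq_continuous_at)
next
  case (Suc n)
  show ?case
    unfolding C_k.simps
  proof (intro conjI allI ballI)
    show "f differentiable at x" if "x \<in> S" for x
      using Suc.prems[OF that] by auto
    show "C_k n S (\<lambda>x. frechet_derivative f (at x) v)" for v
      using Suc.prems by (intro Suc.IH) (metis C_k.simps(2))
  qed
qed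

text \<open>One \<open>L\<close> serves all points, so \<open>f\<close> is affine and its
  directional derivatives are constant; after constants are settled, a case split on
  \<open>n\<close> suffices.\<close>

lemma C_k_affine:
  assumes "\<And>x. (f has_derivative L) (at x)"
  shows "C_k n S f"
proof -
  have const: "C_k m S (\<lambda>_. c)" for m and c :: 'b
    by (induction m arbitrary: c) auto
  have "frechet_derivative f (at x) = L" for x
    using frechet_derivative_at[OF assms] by simp
  then show ?thesis
    using assms const by (cases n)
      (auto simp: differentiable_def intro!: continuous_at_imp_continuous_on has_derivative_continuous)
qed

lemma C_k_const: "C_k n S (\<lambda>_. c)"
  by (rule C_k_affine[where L = "\<lambda>_. 0"]) simp

lemma C_k_bounded_linear_compose:
  assumes "open S" "bounded_linear L" "C_k n S f"
  shows "C_k n S (\<lambda>x. L (f x))"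
  using assms(3)
proof (induction n arbitrary: f)
  case 0
  then show ?case
    using bounded_linear.continuous_on[OF assms(2)] by simp
next
  case (Suc n)
  have d: "((\<lambda>x. L (f x)) has_derivative (\<lambda>v. L (frechet_derivative f (at x) v))) (at x)"
    if "x \<in> S" for x
    using Suc.prems that
    by (intro bounded_linear.has_derivative[OF assms(2)]) (simp flip: frechet_derivative_works)
  have "C_k n S (\<lambda>x. frechet_derivative (\<lambda>x. L (f x)) (at x) v)" for v
    by (rule C_k_cong[OF \<open>open S\<close> _ Suc.IH[of "\<lambda>x. frechet_derivative f (at x) v"]])
       (use Suc.prems frechet_derivative_at[OF d] in \<open>auto simp: fun_eq_iff\<close>)
  then show ?case
    using d by (auto simp: differentiable_def)
qed

lemma C_k_add:
  assumes "open S" "C_k n S f" "C_k n S g"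
  shows "C_k n S (\<lambda>x. f x + g x)"
  using assms(2,3)
proof (induction n arbitrary: f g)
  case 0
  then show ?case by (simp add: continuous_on_add)
next
  case (Suc n)
  have d: "((\<lambda>x. f x + g x) has_derivative
      (\<lambda>v. frechet_derivative f (at x) v + frechet_derivative g (at x) v)) (at x)" if "x \<in> S" for x
    using Suc.prems that by (intro has_derivative_add) (simp_all flip: frechet_derivative_works)
  have "C_k n S (\<lambda>x. frechet_derivative (\<lambda>x. f x + g x) (at x) v)" for v
    by (rule C_k_cong[OF \<open>open S\<close> _ Suc.IH[of "\<lambda>x. frechet_derivative f (at x) v"
            "\<lambda>x. frechet_derivative g (at x) v"]])
       (use Suc.prems frechet_derivative_at[OF d] in \<open>auto simp: fun_eq_iff\<close>)
  then show ?case
    using d by (auto simp: differentiable_def)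
qed

lemma C_k_scaleR:
  fixes f :: "'a::real_normed_vector \<Rightarrow> real"
  assumes "open S" "C_k n S f" "C_k n S g"
  shows "C_k n S (\<lambda>x. f x *\<^sub>R g x)"
  using assms(2,3)
proof (induction n arbitrary: f g)
  case 0
  then show ?case by (simp add: continuous_on_scaleR)
next
  case (Suc n)
  have d: "((\<lambda>x. f x *\<^sub>R g x) has_derivative
      (\<lambda>v. f x *\<^sub>R frechet_derivative g (at x) v + frechet_derivative f (at x) v *\<^sub>R g x)) (at x)"
    if "x \<in> S" for x
    using Suc.prems that by (intro has_derivative_scaleR) (simp_all flip: frechet_derivative_works)
  have "C_k n S (\<lambda>x. frechet_derivative (\<lambda>x. f x *\<^sub>R g x) (at x) v)" for v
  proof (rule C_k_cong[OF \<open>open S\<close>])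
    show "f x *\<^sub>R frechet_derivative g (at x) v + frechet_derivative f (at x) v *\<^sub>R g x
        = frechet_derivative (\<lambda>x. f x *\<^sub>R g x) (at x) v" if "x \<in> S" for x
      using frechet_derivative_at[OF d[OF that]] by (simp add: fun_eq_iff)
    \<comment> \<open>The Leibniz terms contain \<open>f\<close> and \<open>g\<close>
      undifferentiated, so these are lowered by one order before the induction hypothesis
      applies.\<close>
    show "C_k n S (\<lambda>x. f x *\<^sub>R frechet_derivative g (at x) v + frechet_derivative f (at x) v *\<^sub>R g x)"
      using Suc.prems C_k_SucD[OF Suc.prems(1)] C_k_SucD[OF Suc.prems(2)]
      by (intro C_k_add[OF \<open>open S\<close>] Suc.IH) auto
  qed
  then show ?case
    using d by (auto simp: differentiable_def)
qed

lemma C_k_sum: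
  assumes "open S" "finite B" "\<And>b. b \<in> B \<Longrightarrow> C_k n S (f b)"
  shows "C_k n S (\<lambda>x. \<Sum>b\<in>B. f b x)"
  using assms(2,3)
proof (induction B)
  case empty
  then show ?case by (simp add: C_k_const)
next
  case (insert b B)
  then show ?case by (simp add: C_k_add[OF \<open>open S\<close>])
qed

text \<open>The chain rule applies the derivative of \<open>f\<close> at \<open>g x\<close> to a
  vector that varies with \<open>x\<close>, whereas \<open>C_k\<close> controls that derivative only
  in fixed directions. Expanding the vector in \<open>Basis\<close> leaves scalar factors times
  compositions with the same \<open>g\<close>, so the induction generalizes over \<open>f\<close>
  alone.\<close>

lemma C_k_compose:
  fixes g :: "'a::real_normed_vector \<Rightarrow> 'b::euclidean_space"
    and f :: "'b \<Rightarrow> 'c::real_normed_vector"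
  assumes "open S" "open T" "g ` S \<subseteq> T" "C_k n S g" "C_k n T f"
  shows "C_k n S (\<lambda>x. f (g x))"
  using assms(4,5)
proof (induction n arbitrary: f)
  case 0
  then show ?case
    using assms(3) by (auto intro: continuous_on_compose2)
next
  case (Suc n)
  let ?Df = "\<lambda>y. frechet_derivative f (at y)" and ?Dg = "\<lambda>x. frechet_derivative g (at x)"
  have df: "(f has_derivative ?Df (g x)) (at (g x))" and dg: "(g has_derivative ?Dg x) (at x)"
    if "x \<in> S" for x
    using Suc.prems that assms(3) by (auto simp flip: frechet_derivative_works)
  have d: "((\<lambda>x. f (g x)) has_derivative (\<lambda>v. ?Df (g x) (?Dg x v))) (at x)" if "x \<in> S" for x
    using has_derivative_compose[OF dg df] that by simp
  have "C_k n S (\<lambda>x. frechet_derivative (\<lambda>x. f (g x)) (at x) v)" for v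
  proof (rule C_k_cong[OF \<open>open S\<close>])
    show "(\<Sum>b\<in>Basis. (?Dg x v \<bullet> b) *\<^sub>R ?Df (g x) b) = frechet_derivative (\<lambda>x. f (g x)) (at x) v"
      if "x \<in> S" for x
    proof -
      interpret linear "?Df (g x)"
        using df[OF that] by (rule has_derivative_linear)
      have "frechet_derivative (\<lambda>x. f (g x)) (at x) v = ?Df (g x) (\<Sum>b\<in>Basis. (?Dg x v \<bullet> b) *\<^sub>R b)"
        using frechet_derivative_at[OF d[OF that]] by (simp add: fun_eq_iff euclidean_representation)
      then show ?thesis
        by (simp add: sum scale)
    qed
    show "C_k n S (\<lambda>x. \<Sum>b\<in>Basis. (?Dg x v \<bullet> b) *\<^sub>R ?Df (g x) b)"
      using Suc.prems C_k_SucD[OF Suc.prems(1)]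
      by (intro C_k_sum C_k_scaleR C_k_bounded_linear_compose[OF _ bounded_linear_inner_left] Suc.IH
          \<open>open S\<close>) auto
  qed
  then show ?case
    using d by (auto simp: differentiable_def)
qed

lemma smooth_on_cong:
  "open S \<Longrightarrow> (\<And>x. x \<in> S \<Longrightarrow> f x = g x) \<Longrightarrow> smooth_on S f \<Longrightarrow> smooth_on S g"
  unfolding smooth_on_def by (blast intro: C_k_cong)

lemma smooth_on_subset: "smooth_on S f \<Longrightarrow> T \<subseteq> S \<Longrightarrow> smooth_on T f"
  unfolding smooth_on_def by (blast intro: C_k_subset)

lemma smooth_on_local:
  "(\<And>x. x \<in> S \<Longrightarrow> \<exists>T. open T \<and> x \<in> T \<and> smooth_on T f) \<Longrightarrow> smooth_on S f"
  unfolding smooth_on_def by (meson C_k_local)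

lemma smooth_on_const: "smooth_on S (\<lambda>_. c)"
  unfolding smooth_on_def by (blast intro: C_k_const)

lemma smooth_on_add:
  "open S \<Longrightarrow> smooth_on S f \<Longrightarrow> smooth_on S g \<Longrightarrow> smooth_on S (\<lambda>x. f x + g x)"
  unfolding smooth_on_def by (blast intro: C_k_add)

lemma smooth_on_mult:
  fixes f g :: "'a::real_normed_vector \<Rightarrow> real"
  shows "open S \<Longrightarrow> smooth_on S f \<Longrightarrow> smooth_on S g \<Longrightarrow> smooth_on S (\<lambda>x. f x * g x)"
  unfolding smooth_on_def using C_k_scaleR[of S _ f g] by auto

lemma smooth_on_compose:
  fixes g :: "'a::real_normed_vector \<Rightarrow> 'b::euclidean_space"
  shows "open S \<Longrightarrow> open T \<Longrightarrow> g ` S \<subseteq> T \<Longrightarrow> smooth_on S g \<Longrightarrow> smooth_on T f \<Longrightarrow>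
    smooth_on S (\<lambda>x. f (g x))"
  unfolding smooth_on_def by (blast intro: C_k_compose)

lemma smooth_on_differentiable: "smooth_on S f \<Longrightarrow> x \<in> S \<Longrightarrow> f differentiable (at x)"
  unfolding smooth_on_def by (metis C_k.simps(2))

text \<open>\<open>frechet_derivative\<close> is a choice among the maps satisfying
  \<open>has_derivative\<close>. Functions that agree near \<open>x\<close> have the same
  candidates, hence the same choice, differentiable or not.\<close>

lemma frechet_derivative_cong_open:
  assumes "open S" "x \<in> S" "\<And>y. y \<in> S \<Longrightarrow> f y = g y"
  shows "frechet_derivative f (at x) = frechet_derivative g (at x)"
proof -
  have "(f has_derivative D) (at x) \<longleftrightarrow> (g has_derivative D) (at x)" for D
    using assms by (metis has_derivative_transform_within_open)
  then show ?thesis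
    by (simp add: frechet_derivative_def)
qed

section \<open>Derivations and differential forms\<close>

text \<open>The body of \<open>smooth_near\<close> for one given neighbourhood: closure under sums
  and products is proved on a common set, and neighbourhoods are intersected afterwards.\<close>

definition smooth_within :: "('a, 'e::euclidean_space) atlas \<Rightarrow> 'a set \<Rightarrow> ('a \<Rightarrow> real) \<Rightarrow> bool" where
  "smooth_within A W f \<longleftrightarrow> (\<forall>(U, h)\<in>A. smooth_on (h ` (U \<inter> W)) (f \<circ> inv_into U h))"

lemma smooth_withinD:
  "smooth_within A W f \<Longrightarrow> (U, h) \<in> A \<Longrightarrow> smooth_on (h ` (U \<inter> W)) (f \<circ> inv_into U h)"
  unfolding smooth_within_def by blast

lemma smooth_within_subset: "smooth_within A W f \<Longrightarrow> V \<subseteq> W \<Longrightarrow> smooth_within A V f"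
  unfolding smooth_within_def
  by (auto intro: smooth_on_subset[where T = "_ ` (_ \<inter> V)"] dest!: bspec)

lemma smooth_within_const: "smooth_within A W (\<lambda>_. c)"
  unfolding smooth_within_def by (auto simp: o_def smooth_on_const)

lemma smooth_near_iff:
  "f \<in> smooth_near A p \<longleftrightarrow> (\<exists>W. p \<in> W \<and> openin (atlas_topology A) W \<and> smooth_within A W f)"
  unfolding smooth_near_def smooth_within_def by blast

lemma tangent_add:
  "v \<in> tangent_space A p \<Longrightarrow> f \<in> smooth_near A p \<Longrightarrow> g \<in> smooth_near A p \<Longrightarrow>
    v (\<lambda>x. f x + g x) = v f + v g"
  unfolding tangent_space_def by blast

lemma tangent_cmult:
  "v \<in> tangent_space A p \<Longrightarrow> f \<in> smooth_near A p \<Longrightarrow> v (\<lambda>x. c * f x) = c * v f"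
  unfolding tangent_space_def by blast

lemma tangent_mult:
  "v \<in> tangent_space A p \<Longrightarrow> f \<in> smooth_near A p \<Longrightarrow> g \<in> smooth_near A p \<Longrightarrow>
    v (\<lambda>x. f x * g x) = v f * g p + f p * v g"
  unfolding tangent_space_def by blast

lemma tangent_outside: "v \<in> tangent_space A p \<Longrightarrow> f \<notin> smooth_near A p \<Longrightarrow> v f = 0"
  unfolding tangent_space_def by blast

text \<open>Collects conditions on single charts that hold for the Lie group, the product atlas and
  the quotient atlas alike, so that the calculus of derivations and forms is available on all of
  them.\<close>

locale open_atlas =
  fixes A :: "('a, 'e::euclidean_space) atlas"
  assumes inj_chart: "(U, h) \<in> A \<Longrightarrow> inj_on h U"
    and open_chart: "(U, h) \<in> A \<Longrightarrow> open (h ` U)"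
begin

text \<open>\<open>topology\<close> inverts \<open>openin\<close> only on predicates that satisfy
  \<open>istopology\<close>. Closure under intersections is where injectivity of the charts enters:
  it makes images commute with intersections.\<close>

lemma openin_atlas_topology:
  "openin (atlas_topology A) W \<longleftrightarrow> W \<subseteq> points A \<and> (\<forall>(U, h)\<in>A. open (h ` (W \<inter> U)))"
proof -
  let ?P = "\<lambda>W. W \<subseteq> points A \<and> (\<forall>(U, h)\<in>A. open (h ` (W \<inter> U)))"
  have "istopology ?P"
    unfolding istopology_def
  proof (intro conjI[of "\<forall>S T. ?P S \<longrightarrow> ?P T \<longrightarrow> ?P (S \<inter> T)"] allI impI)
    fix S T assume S: "?P S" and T: "?P T"
    have "h ` (S \<inter> T \<inter> U) = h ` (S \<inter> U) \<inter> h ` (T \<inter> U)" if "(U, h) \<in> A" for U h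
      using inj_chart[OF that] by (auto simp: inj_on_def)
    then show "S \<inter> T \<subseteq> points A \<and> (\<forall>(U, h)\<in>A. open (h ` (S \<inter> T \<inter> U)))"
      using S T by fastforce
  next
    fix K assume K: "\<forall>W\<in>K. ?P W"
    have "h ` (\<Union>K \<inter> U) = (\<Union>W\<in>K. h ` (W \<inter> U))" for U and h :: "'a \<Rightarrow> 'e"
      by auto
    then show "\<Union>K \<subseteq> points A \<and> (\<forall>(U, h)\<in>A. open (h ` (\<Union>K \<inter> U)))"
      using K by (auto intro!: open_UN)
  qed
  then show ?thesis
    by (simp add: atlas_topology_def topology_inverse')
qed

lemma open_chart_image: "openin (atlas_topology A) W \<Longrightarrow> (U, h) \<in> A \<Longrightarrow> open (h ` (U \<inter> W))"
  by (auto simp: openin_atlas_topology Int_commute)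

lemma openin_points: "openin (atlas_topology A) (points A)"
proof -
  have "points A \<inter> U = U" if "(U, h) \<in> A" for U h
    using that by (auto simp: points_def)
  then show ?thesis
    by (auto simp: openin_atlas_topology open_chart)
qed

lemma topspace_atlas_topology: "topspace (atlas_topology A) = points A"
  by (meson openin_atlas_topology openin_points openin_subset openin_topspace subset_antisym)

lemma inv_chart: "(U, h) \<in> A \<Longrightarrow> p \<in> U \<Longrightarrow> inv_into U h (h p) = p"
  using inj_chart by simp

lemma smooth_within_cong:
  assumes "openin (atlas_topology A) W" "\<And>x. x \<in> W \<Longrightarrow> f x = g x" "smooth_within A W f"
  shows "smooth_within A W g"
  unfolding smooth_within_def
proof clarify
  fix U h assume c: "(U, h) \<in> A"
  show "smooth_on (h ` (U \<inter> W)) (g \<circ> inv_into U h)"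
    by (rule smooth_on_cong[OF open_chart_image[OF assms(1) c] _ smooth_withinD[OF assms(3) c]])
       (use assms(2) inv_chart[OF c] in auto)
qed

lemma smooth_within_add:
  assumes "openin (atlas_topology A) W" "smooth_within A W f" "smooth_within A W g"
  shows "smooth_within A W (\<lambda>x. f x + g x)"
  unfolding smooth_within_def
proof clarify
  fix U h assume c: "(U, h) \<in> A"
  show "smooth_on (h ` (U \<inter> W)) ((\<lambda>x. f x + g x) \<circ> inv_into U h)"
    using smooth_on_add[OF open_chart_image[OF assms(1) c] assms(2,3)[THEN smooth_withinD, OF c]]
    by (simp add: o_def)
qed

lemma smooth_within_mult:
  assumes "openin (atlas_topology A) W" "smooth_within A W f" "smooth_within A W g"
  shows "smooth_within A W (\<lambda>x. f x * g x)"
  unfolding smooth_within_def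
proof clarify
  fix U h assume c: "(U, h) \<in> A"
  show "smooth_on (h ` (U \<inter> W)) ((\<lambda>x. f x * g x) \<circ> inv_into U h)"
    using smooth_on_mult[OF open_chart_image[OF assms(1) c] assms(2,3)[THEN smooth_withinD, OF c]]
    by (simp add: o_def)
qed

lemma smooth_near_common:
  assumes "f \<in> smooth_near A p" "g \<in> smooth_near A p"
  obtains W where "p \<in> W" "openin (atlas_topology A) W" "smooth_within A W f" "smooth_within A W g"
proof -
  obtain V W where "p \<in> V" "openin (atlas_topology A) V" "smooth_within A V f"
    "p \<in> W" "openin (atlas_topology A) W" "smooth_within A W g"
    using assms unfolding smooth_near_iff by blast
  then show thesis
    by (intro that[of "V \<inter> W"]) (auto intro: smooth_within_subset)
qed

lemma smooth_near_add:
  "f \<in> smooth_near A p \<Longrightarrow> g \<in> smooth_near A p \<Longrightarrow> (\<lambda>x. f x + g x) \<in> smooth_near A p"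
  by (erule (1) smooth_near_common) (auto simp: smooth_near_iff intro: smooth_within_add)

lemma smooth_near_mult:
  "f \<in> smooth_near A p \<Longrightarrow> g \<in> smooth_near A p \<Longrightarrow> (\<lambda>x. f x * g x) \<in> smooth_near A p"
  by (erule (1) smooth_near_common) (auto simp: smooth_near_iff intro: smooth_within_mult)

lemma smooth_near_const: "p \<in> points A \<Longrightarrow> (\<lambda>_. c) \<in> smooth_near A p"
  unfolding smooth_near_iff using openin_points smooth_within_const by blast

lemma smooth_near_cmult:
  assumes "f \<in> smooth_near A p"
  shows "(\<lambda>x. c * f x) \<in> smooth_near A p"
proof -
  have "p \<in> points A"
    using assms openin_subset unfolding smooth_near_iff topspace_atlas_topology[symmetric] by blast
  then show ?thesis
    using smooth_near_mult[OF smooth_near_const assms] by blast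
qed

lemma smooth_near_cong:
  assumes "f \<in> smooth_near A p" "openin (atlas_topology A) V" "p \<in> V" "\<And>x. x \<in> V \<Longrightarrow> f x = g x"
  shows "g \<in> smooth_near A p"
proof -
  obtain W where W: "p \<in> W" "openin (atlas_topology A) W" "smooth_within A W f"
    using assms(1) unfolding smooth_near_iff by blast
  have "smooth_within A (V \<inter> W) g"
  proof (rule smooth_within_cong)
    show "openin (atlas_topology A) (V \<inter> W)" "smooth_within A (V \<inter> W) f"
      using assms(2) W by (auto intro: smooth_within_subset)
  qed (use assms(4) in blast)
  then show ?thesis
    unfolding smooth_near_iff using assms(2,3) W by (intro exI[of _ "V \<inter> W"]) auto
qed

text \<open>The Leibniz rule for the product of \<open>f - g\<close> with the indicator function of \<open>V\<close>,
  which vanishes identically.\<close>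
lemma tangent_local:
  assumes v: "v \<in> tangent_space A p" and f: "f \<in> smooth_near A p"
    and V: "openin (atlas_topology A) V" "p \<in> V" and eq: "\<And>x. x \<in> V \<Longrightarrow> f x = g x"
  shows "v f = v g"
proof -
  let ?d = "\<lambda>x. f x + (-1) * g x" and ?i = "\<lambda>x. if x \<in> V then 1 else (0::real)"
  have p: "p \<in> points A"
    using V openin_subset unfolding topspace_atlas_topology[symmetric] by blast
  have g: "g \<in> smooth_near A p"
    using smooth_near_cong[OF f V eq] by simp
  have i: "?i \<in> smooth_near A p"
    by (rule smooth_near_cong[OF smooth_near_const[OF p, of 1] V]) simp
  have d: "?d \<in> smooth_near A p"
    using smooth_near_add[OF f smooth_near_cmult[OF g]] .
  have "0 = v (\<lambda>x. 0 * f x)"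
    using tangent_cmult[OF v f, of 0] by simp
  also have "(\<lambda>x. 0 * f x) = (\<lambda>x. ?i x * ?d x)"
    using eq by auto
  also have "v \<dots> = v ?d"
    using tangent_mult[OF v i d] V(2) eq by simp
  also have "\<dots> = v f - v g"
    using tangent_add[OF v f smooth_near_cmult[OF g, of "-1"]] tangent_cmult[OF v g, of "-1"] by simp
  finally show ?thesis by simp
qed

section \<open>Coordinate vectors and push-forwards as derivations\<close>

lemma smooth_near_differentiable:
  assumes "f \<in> smooth_near A p" "(U, h) \<in> A" "p \<in> U"
  shows "(f \<circ> inv_into U h) differentiable (at (h p))"
  using assms unfolding smooth_near_iff
  by (auto intro: smooth_on_differentiable[OF smooth_withinD[OF _ assms(2)]])

text \<open>These are the sum and product rules for \<open>f \<circ> inv_into U h\<close>, whose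
  value at \<open>h p\<close> is \<open>f p\<close>. The default value 0 outside
  \<open>smooth_near\<close> is what the last clause of \<open>tangent_space\<close> asks
  for.\<close>

lemma coord_vector_tangent:
  assumes c: "(U, h) \<in> A" "p \<in> U"
  shows "coord_vector A U h b p \<in> tangent_space A p"
proof -
  have D: "((f \<circ> inv_into U h) has_derivative frechet_derivative (f \<circ> inv_into U h) (at (h p)))
      (at (h p))" if "f \<in> smooth_near A p" for f
    using smooth_near_differentiable[OF that c] by (simp flip: frechet_derivative_works)
  have eq: "coord_vector A U h b p f = D b"
    if "f \<in> smooth_near A p" "((f \<circ> inv_into U h) has_derivative D) (at (h p))" for f D
    using that frechet_derivative_at[OF that(2)] by (simp add: coord_vector_def)
  have *: "coord_vector A U h b p f = frechet_derivative (f \<circ> inv_into U h) (at (h p)) b"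
    if "f \<in> smooth_near A p" for f
    using that by (simp add: coord_vector_def)
  show ?thesis
    unfolding tangent_space_def
  proof (intro CollectI conjI ballI allI impI)
    fix f g assume f: "f \<in> smooth_near A p" and g: "g \<in> smooth_near A p"
    show "coord_vector A U h b p (\<lambda>x. f x + g x) =
        coord_vector A U h b p f + coord_vector A U h b p g"
      unfolding *[OF f] *[OF g]
      by (rule eq[OF smooth_near_add[OF f g]])
         (use has_derivative_add[OF D[OF f] D[OF g]] in \<open>simp add: o_def\<close>)
    show "coord_vector A U h b p (\<lambda>x. f x * g x) =
        coord_vector A U h b p f * g p + f p * coord_vector A U h b p g"
      unfolding *[OF f] *[OF g]
      using eq[OF smooth_near_mult[OF f g]] has_derivative_mult[OF D[OF f] D[OF g]] inv_chart[OF c]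
      by (simp add: o_def)
  next
    fix c f assume f: "f \<in> smooth_near A p"
    show "coord_vector A U h b p (\<lambda>x. c * f x) = c * coord_vector A U h b p f"
      unfolding *[OF f]
      by (rule eq[OF smooth_near_cmult[OF f]])
         (use has_derivative_mult_right[OF D[OF f]] in \<open>simp add: o_def\<close>)
  qed (simp add: coord_vector_def)
qed

end

text \<open>Smoothness of \<open>F\<close> enters as the pull-back of functions smooth near
  \<open>F p\<close>, the form in which it is proved for translations and for local sections of the
  projection.\<close>

lemma push_forward_tangent:
  assumes "open_atlas B"
    and F: "\<And>f. f \<in> smooth_near B (F p) \<Longrightarrow> f \<circ> F \<in> smooth_near A p"
    and v: "v \<in> tangent_space A p"
  shows "push_forward A B F p v \<in> tangent_space B (F p)"
proof -
  interpret B: open_atlas B by fact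
  have *: "push_forward A B F p v f = v (f \<circ> F)" if "f \<in> smooth_near B (F p)" for f
    using that by (simp add: push_forward_def)
  show ?thesis
    unfolding tangent_space_def
  proof (intro CollectI conjI ballI allI impI)
    fix f g assume f: "f \<in> smooth_near B (F p)" and g: "g \<in> smooth_near B (F p)"
    show "push_forward A B F p v (\<lambda>x. f x + g x) = push_forward A B F p v f + push_forward A B F p v g"
      using tangent_add[OF v F[OF f] F[OF g]]
      by (simp add: * f g B.smooth_near_add comp_def)
    show "push_forward A B F p v (\<lambda>x. f x * g x) =
        push_forward A B F p v f * g (F p) + f (F p) * push_forward A B F p v g"
      using tangent_mult[OF v F[OF f] F[OF g]]
      by (simp add: * f g B.smooth_near_mult comp_def)
  next
    fix c f assume f: "f \<in> smooth_near B (F p)"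
    show "push_forward A B F p v (\<lambda>x. c * f x) = c * push_forward A B F p v f"
      using tangent_cmult[OF v F[OF f]] by (simp add: * f B.smooth_near_cmult comp_def)
  qed (simp add: push_forward_def)
qed

section \<open>Smooth 1-forms and exterior derivatives\<close>

lemma smooth_functionD: "smooth_function A f \<Longrightarrow> (U, h) \<in> A \<Longrightarrow> smooth_on (h ` U) (f \<circ> inv_into U h)"
  unfolding smooth_function_def by blast

lemma smooth_form1D:
  "smooth_form1 A \<omega> \<Longrightarrow> (U, h) \<in> A \<Longrightarrow> b \<in> Basis \<Longrightarrow> smooth_on (h ` U) (form_component A U h \<omega> b)"
  unfolding smooth_form1_def by blast

context open_atlas
begin

text \<open>The coefficients are functions because \<phi> has the coefficients \<open>I\<close> and
  \<open>J\<close>; a difference of forms is the case of the constants 1 and -1.\<close>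

lemma smooth_form1_lincomb:
  assumes "smooth_function A f" "smooth_function A g" "smooth_form1 A \<alpha>" "smooth_form1 A \<beta>"
  shows "smooth_form1 A (\<lambda>p v. f p * \<alpha> p v + g p * \<beta> p v)"
  unfolding smooth_form1_def
proof (intro conjI ballI; clarify?)
  fix p assume "p \<in> points A"
  then have "covector A p (\<alpha> p)" "covector A p (\<beta> p)"
    using assms(3,4) by (auto simp: smooth_form1_def)
  then show "covector A p (\<lambda>v. f p * \<alpha> p v + g p * \<beta> p v)"
    by (simp add: covector_def algebra_simps)
next
  fix U h and b :: 'e assume c: "(U, h) \<in> A" and b: "b \<in> Basis"
  have "smooth_on (h ` U) (\<lambda>x. (f \<circ> inv_into U h) x * form_component A U h \<alpha> b x
      + (g \<circ> inv_into U h) x * form_component A U h \<beta> b x)"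
    by (intro smooth_on_add smooth_on_mult open_chart c smooth_functionD[OF assms(1) c]
        smooth_functionD[OF assms(2) c] smooth_form1D[OF assms(3) c b] smooth_form1D[OF assms(4) c b])
  then show "smooth_on (h ` U) (form_component A U h (\<lambda>p v. f p * \<alpha> p v + g p * \<beta> p v) b)"
    by (simp add: form_component_def[abs_def])
qed

lemma smooth_function_const: "smooth_function A (\<lambda>_. c)"
  unfolding smooth_function_def by (auto simp: o_def smooth_on_const)

lemma smooth_form1_diff:
  "smooth_form1 A \<alpha> \<Longrightarrow> smooth_form1 A \<beta> \<Longrightarrow> smooth_form1 A (\<lambda>p v. \<alpha> p v - \<beta> p v)"
  using smooth_form1_lincomb[of "\<lambda>_. 1" "\<lambda>_. -1" \<alpha> \<beta>] smooth_function_const by simp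

text \<open>Smoothness of both forms makes their components differentiable, without which
  \<open>frechet_derivative\<close> of a difference need not split.\<close>

lemma has_exterior_derivative_diff:
  assumes "smooth_form1 A \<alpha>" "smooth_form1 A \<beta>"
    and "has_exterior_derivative A \<alpha> \<eta>" "has_exterior_derivative A \<beta> \<theta>"
  shows "has_exterior_derivative A (\<lambda>p v. \<alpha> p v - \<beta> p v) (\<lambda>p u v. \<eta> p u v - \<theta> p u v)"
  unfolding has_exterior_derivative_def
proof clarify
  fix U h p and a b :: 'e
  assume c: "(U, h) \<in> A" and p: "p \<in> U" and a: "a \<in> Basis" and b: "b \<in> Basis"
  have D: "(form_component A U h \<omega> i has_derivative
      frechet_derivative (form_component A U h \<omega> i) (at (h p))) (at (h p))"
    if "smooth_form1 A \<omega>" "i \<in> Basis" for \<omega> i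
    using smooth_on_differentiable[OF smooth_form1D[OF that(1) c that(2)]] p
    by (auto simp flip: frechet_derivative_works)
  have eq: "frechet_derivative (form_component A U h (\<lambda>p v. \<alpha> p v - \<beta> p v) i) (at (h p)) j =
      frechet_derivative (form_component A U h \<alpha> i) (at (h p)) j -
      frechet_derivative (form_component A U h \<beta> i) (at (h p)) j" if "i \<in> Basis" for i j
    using frechet_derivative_at[OF has_derivative_diff[OF D[OF assms(1) that] D[OF assms(2) that]]]
    by (simp add: form_component_def[abs_def] fun_eq_iff)
  have "frechet_derivative (form_component A U h \<alpha> b) (at (h p)) a
      - frechet_derivative (form_component A U h \<alpha> a) (at (h p)) b
      = \<eta> p (coord_vector A U h a p) (coord_vector A U h b p)"
    "frechet_derivative (form_component A U h \<beta> b) (at (h p)) a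
      - frechet_derivative (form_component A U h \<beta> a) (at (h p)) b
      = \<theta> p (coord_vector A U h a p) (coord_vector A U h b p)"
    using assms(3,4) c p a b unfolding has_exterior_derivative_def by blast+
  then show "frechet_derivative (form_component A U h (\<lambda>p v. \<alpha> p v - \<beta> p v) b) (at (h p)) a
      - frechet_derivative (form_component A U h (\<lambda>p v. \<alpha> p v - \<beta> p v) a) (at (h p)) b
      = \<eta> p (coord_vector A U h a p) (coord_vector A U h b p)
        - \<theta> p (coord_vector A U h a p) (coord_vector A U h b p)"
    by (simp add: eq a b)
qed

end

section \<open>From a Cartan structure to a generalized Finsler structure\<close>

text \<open>With \<omega>2 = \<phi> - \<alpha>3, wedging by \<alpha>2 kills the \<open>J\<close>
  term and wedging by \<alpha>1 kills the \<open>I\<close> term: \<omega>2 \<and> \<alpha>2 = I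
  \<alpha>1 \<and> \<alpha>2 + \<alpha>2 \<and> \<alpha>3 and \<alpha>1 \<and> \<omega>2 = J
  \<alpha>1 \<and> \<alpha>2 + \<alpha>3 \<and> \<alpha>1. The correction terms with
  \<open>I\<close> and \<open>J\<close> in the structure equations cancel exactly these multiples of
  \<alpha>1 \<and> \<alpha>2. In d\<omega>2 the function \<K> cancels: (\<K> - 1) - \<K> =
  -1.\<close>

lemma generalized_finsler_of_cartan:
  fixes A :: "('a, real ^ 3) atlas"
  assumes "open_atlas A" and cartan: "cartan_structure A \<K> \<alpha>1 \<alpha>2 \<alpha>3"
    and I: "smooth_function A I" and J: "smooth_function A J"
    and \<phi>: "\<phi> = (\<lambda>p v. I p * \<alpha>1 p v + J p * \<alpha>2 p v)"
    and d\<phi>: "has_exterior_derivative A \<phi> (\<lambda>p u v. (\<K> p - 1) * wedge \<alpha>1 \<alpha>2 p u v)"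
  shows "generalized_finsler A I J \<alpha>1 (\<lambda>p v. \<phi> p v - \<alpha>3 p v) \<alpha>2"
proof -
  interpret open_atlas A by fact
  let ?\<omega> = "\<lambda>p v. \<phi> p v - \<alpha>3 p v"
  have \<alpha>: "smooth_form1 A \<alpha>1" "smooth_form1 A \<alpha>2" "smooth_form1 A \<alpha>3"
    and d1: "has_exterior_derivative A \<alpha>1 (wedge \<alpha>2 \<alpha>3)"
    and d2: "has_exterior_derivative A \<alpha>2 (wedge \<alpha>3 \<alpha>1)"
    and d3: "has_exterior_derivative A \<alpha>3 (\<lambda>p u v. \<K> p * wedge \<alpha>1 \<alpha>2 p u v)"
    and indep: "\<And>p a b c. p \<in> points A \<Longrightarrow>
      \<forall>v\<in>tangent_space A p. a * \<alpha>1 p v + b * \<alpha>2 p v + c * \<alpha>3 p v = 0 \<Longrightarrow> a = 0 \<and> b = 0 \<and> c = 0"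
    and span: "\<And>p l. p \<in> points A \<Longrightarrow> covector A p l \<Longrightarrow>
      \<exists>a b c. \<forall>v\<in>tangent_space A p. l v = a * \<alpha>1 p v + b * \<alpha>2 p v + c * \<alpha>3 p v"
    using cartan unfolding cartan_structure_def coframe_def by blast+
  have \<phi>_smooth: "smooth_form1 A \<phi>"
    unfolding \<phi> by (rule smooth_form1_lincomb[OF I J \<alpha>(1,2)])
  have "coframe A \<alpha>1 ?\<omega> \<alpha>2"
    unfolding coframe_def
  proof (intro conjI ballI)
    show "smooth_form1 A ?\<omega>"
      using \<phi>_smooth \<alpha>(3) by (rule smooth_form1_diff)
  next
    fix p assume p: "p \<in> points A"
    show "\<forall>a b c. (\<forall>v\<in>tangent_space A p. a * \<alpha>1 p v + b * ?\<omega> p v + c * \<alpha>2 p v = 0) \<longrightarrow>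
        a = 0 \<and> b = 0 \<and> c = 0"
    proof (intro allI impI)
      fix a b c assume "\<forall>v\<in>tangent_space A p. a * \<alpha>1 p v + b * ?\<omega> p v + c * \<alpha>2 p v = 0"
      \<comment> \<open>The coefficients of \<alpha>1, \<alpha>2, \<alpha>3 after expanding \<phi>;
        the last one gives b = 0, and then the other two reduce to a and c.\<close>
      then have "a + b * I p = 0 \<and> c + b * J p = 0 \<and> - b = 0"
        by (intro indep[OF p]) (simp add: \<phi> algebra_simps)
      then show "a = 0 \<and> b = 0 \<and> c = 0" by force
    qed
    show "\<forall>l. covector A p l \<longrightarrow>
        (\<exists>a b c. \<forall>v\<in>tangent_space A p. l v = a * \<alpha>1 p v + b * ?\<omega> p v + c * \<alpha>2 p v)"
    proof (intro allI impI)
      fix l assume "covector A p l"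
      then obtain a b c where l: "\<forall>v\<in>tangent_space A p. l v = a * \<alpha>1 p v + b * \<alpha>2 p v + c * \<alpha>3 p v"
        using span[OF p] by blast
      \<comment> \<open>The witnesses come from substituting \<alpha>3 = I \<alpha>1 + J \<alpha>2 -
        \<omega>2.\<close>
      show "\<exists>a b c. \<forall>v\<in>tangent_space A p. l v = a * \<alpha>1 p v + b * ?\<omega> p v + c * \<alpha>2 p v"
        by (rule exI[of _ "a + c * I p"], rule exI[of _ "- c"], rule exI[of _ "b + c * J p"])
           (simp add: l \<phi> algebra_simps)
    qed
  qed (use \<alpha> in auto)
  moreover have "has_exterior_derivative A \<alpha>1
      (\<lambda>p u v. - I p * wedge \<alpha>1 \<alpha>2 p u v + wedge ?\<omega> \<alpha>2 p u v)"
    using d1 by (simp add: \<phi> wedge_def[abs_def] algebra_simps)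
  moreover have "has_exterior_derivative A ?\<omega> (\<lambda>p u v. - wedge \<alpha>1 \<alpha>2 p u v)"
    using has_exterior_derivative_diff[OF \<phi>_smooth \<alpha>(3) d\<phi> d3] by (simp add: algebra_simps)
  moreover have "has_exterior_derivative A \<alpha>2
      (\<lambda>p u v. wedge \<alpha>1 ?\<omega> p u v - J p * wedge \<alpha>1 \<alpha>2 p u v)"
    using d2 by (simp add: \<phi> wedge_def[abs_def] algebra_simps)
  ultimately show ?thesis
    using I J by (simp add: generalized_finsler_def)
qed

section \<open>Quotients of Lie groups by discrete subgroups\<close>

locale lie_group_quotient =
  fixes G :: "'g monoid" (structure) and A :: "('g, 'e::euclidean_space) atlas" and \<Gamma> :: "'g set"
  assumes lie_group: "lie_group G A" and discrete: "discrete_subgroup \<Gamma> G A"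
begin

sublocale group G
  using lie_group by (simp add: lie_group_def)

sublocale A: open_atlas A
  using lie_group by unfold_locales (auto simp: lie_group_def smooth_manifold_def)

abbreviation q :: "'g \<Rightarrow> 'g set" where "q \<equiv> (\<lambda>g. \<Gamma> #> g)"

abbreviation Q :: "('g set, 'e) atlas" where "Q \<equiv> left_quotient G A \<Gamma>"

lemma subgroup_\<Gamma>: "subgroup \<Gamma> G"
  using discrete by (simp add: discrete_subgroup_def)

lemma \<Gamma>_carrier: "\<gamma> \<in> \<Gamma> \<Longrightarrow> \<gamma> \<in> carrier G"
  by (rule subgroup.mem_carrier[OF subgroup_\<Gamma>])

lemma points_A: "points A = carrier G"
  using lie_group by (simp add: lie_group_def)

lemma open_subset_carrier: "openin (atlas_topology A) W \<Longrightarrow> W \<subseteq> carrier G"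
  using A.openin_atlas_topology points_A by simp

lemma chart_at:
  assumes "g \<in> carrier G" obtains U h where "(U, h) \<in> A" "g \<in> U"
  using assms unfolding points_A[symmetric] points_def by auto

lemma openin_chart_domain:
  assumes "(U, h) \<in> A" shows "openin (atlas_topology A) U"
proof -
  have "open (k ` (U \<inter> V))" if "(V, k) \<in> A" for V k
    using lie_group assms that unfolding lie_group_def smooth_manifold_def
    by (auto simp: Int_commute[of U])
  moreover have "U \<subseteq> points A"
    using assms by (auto simp: points_def)
  ultimately show ?thesis
    by (auto simp: A.openin_atlas_topology)
qed

text \<open>Seen in another chart, \<open>h\<close> is a transition map, and order 0 of its
  smoothness is continuity.\<close>

lemma openin_chart_preimage:
  assumes c: "(U, h) \<in> A" and S: "open S"
  shows "openin (atlas_topology A) {x \<in> U. h x \<in> S}"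
  unfolding A.openin_atlas_topology
proof (intro conjI; clarify?)
  fix V k assume d: "(V, k) \<in> A"
  have "open (k ` (V \<inter> U)) \<and> smooth_on (k ` (V \<inter> U)) (h \<circ> inv_into V k)"
    using lie_group c d unfolding lie_group_def smooth_manifold_def by fast
  then have "open (k ` (V \<inter> U))" "continuous_on (k ` (V \<inter> U)) (h \<circ> inv_into V k)"
    unfolding smooth_on_def by (blast, metis C_k.simps(1))
  then have "open (k ` (V \<inter> U) \<inter> (h \<circ> inv_into V k) -` S)"
    using S by (metis continuous_open_preimage)
  moreover have "k ` ({x \<in> U. h x \<in> S} \<inter> V) = k ` (V \<inter> U) \<inter> (h \<circ> inv_into V k) -` S"
    using A.inv_chart[OF d] by auto
  ultimately show "open (k ` ({x \<in> U. h x \<in> S} \<inter> V))" by simp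
qed (use c in \<open>auto simp: points_def\<close>)

section \<open>Left translations obtained from the multiplication\<close>

lemma open_atlas_prod: "open_atlas (prod_atlas A A)"
proof
  fix U h assume "(U, h) \<in> prod_atlas A A"
  then obtain V k W l where "U = V \<times> W" "h = map_prod k l" "(V, k) \<in> A" "(W, l) \<in> A"
    by (auto simp: prod_atlas_def)
  then show "inj_on h U" "open (h ` U)"
    using A.inj_chart A.open_chart by (auto simp: map_prod_inj_on map_prod_surj_on[OF refl refl] open_Times)
qed

lemma openin_mult_preimage:
  assumes "openin (atlas_topology A) W"
  shows "openin (atlas_topology (prod_atlas A A)) {z \<in> carrier G \<times> carrier G. fst z \<otimes> snd z \<in> W}"
proof -
  interpret P: open_atlas "prod_atlas A A" by (rule open_atlas_prod)
  have "points (prod_atlas A A) = points A \<times> points A"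
    unfolding points_def prod_atlas_def by fast
  then have "topspace (atlas_topology (prod_atlas A A)) = carrier G \<times> carrier G"
    by (simp add: P.topspace_atlas_topology points_A)
  moreover have "continuous_map (atlas_topology (prod_atlas A A)) (atlas_topology A) (\<lambda>(x, y). x \<otimes> y)"
    using lie_group by (simp add: lie_group_def smooth_map_def)
  ultimately show ?thesis
    using openin_continuous_map_preimage[OF _ assms] by (fastforce simp: case_prod_beta)
qed

text \<open>Moves an open set of the product manifold into a Euclidean space, where slices and boxes
  can be taken; the atlas topology itself is not compared with the product topology.\<close>

lemma open_prod_chart:
  assumes "openin (atlas_topology (prod_atlas A A)) Z" "(U, h) \<in> A" "(V, k) \<in> A"
  shows "open (map_prod h k ` (Z \<inter> U \<times> V))"
proof -
  interpret P: open_atlas "prod_atlas A A" by (rule open_atlas_prod)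
  have "(U \<times> V, map_prod h k) \<in> prod_atlas A A"
    using assms by (auto simp: prod_atlas_def)
  then show ?thesis
    using assms(1) by (auto simp: P.openin_atlas_topology)
qed

lemma open_slice: "open Z \<Longrightarrow> open {y. (c, y) \<in> Z}"
  using continuous_on_open_vimage[OF open_UNIV, of "Pair c"]
  by (auto simp: vimage_def intro!: continuous_on_Pair)

text \<open>In charts the set is the slice, at first coordinate \<open>k \<gamma>\<close>, of the
  open set of pairs with product in \<open>W\<close>. Injectivity of \<open>k\<close> ensures that
  only \<gamma> contributes to this slice.\<close>

lemma openin_translate:
  assumes \<gamma>: "\<gamma> \<in> carrier G" and W: "openin (atlas_topology A) W"
  shows "openin (atlas_topology A) {x \<in> carrier G. \<gamma> \<otimes> x \<in> W}"
  unfolding A.openin_atlas_topology points_A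
proof (intro conjI ballI; clarify?)
  obtain V k where V: "(V, k) \<in> A" "\<gamma> \<in> V"
    using \<gamma> by (rule chart_at)
  fix U h assume c: "(U, h) \<in> A"
  have U: "U \<subseteq> carrier G"
    using open_subset_carrier[OF openin_chart_domain[OF c]] .
  let ?Z = "map_prod k h ` ({z \<in> carrier G \<times> carrier G. fst z \<otimes> snd z \<in> W} \<inter> V \<times> U)"
  have "h ` ({x \<in> carrier G. \<gamma> \<otimes> x \<in> W} \<inter> U) = {y. (k \<gamma>, y) \<in> ?Z}"
  proof (intro equalityI subsetI)
    fix y assume "y \<in> h ` ({x \<in> carrier G. \<gamma> \<otimes> x \<in> W} \<inter> U)"
    then obtain x where "x \<in> carrier G" "\<gamma> \<otimes> x \<in> W" "x \<in> U" "y = h x" by blast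
    then show "y \<in> {y. (k \<gamma>, y) \<in> ?Z}"
      using V(2) \<gamma> by (auto intro: rev_image_eqI[of "(\<gamma>, x)"])
  next
    fix y assume "y \<in> {y. (k \<gamma>, y) \<in> ?Z}"
    then obtain \<gamma>' x where "\<gamma>' \<in> V" "k \<gamma> = k \<gamma>'" "x \<in> carrier G" "\<gamma>' \<otimes> x \<in> W" "x \<in> U" "y = h x"
      by auto
    then show "y \<in> h ` ({x \<in> carrier G. \<gamma> \<otimes> x \<in> W} \<inter> U)"
      using inj_onD[OF A.inj_chart[OF V(1)], of \<gamma> \<gamma>'] V(2) by auto
  qed
  then show "open (h ` ({x \<in> carrier G. \<gamma> \<otimes> x \<in> W} \<inter> U))"
    using open_slice[OF open_prod_chart[OF openin_mult_preimage[OF W] V(1) c]] by simp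
qed

lemma smooth_within_translate:
  assumes \<gamma>: "\<gamma> \<in> carrier G" and W: "openin (atlas_topology A) W" and f: "smooth_within A W f"
  shows "smooth_within A {x \<in> carrier G. \<gamma> \<otimes> x \<in> W} (\<lambda>x. f (\<gamma> \<otimes> x))"
  unfolding smooth_within_def
proof clarify
  fix U h assume c: "(U, h) \<in> A"
  obtain Z l where Z: "(Z, l) \<in> A" "\<gamma> \<in> Z"
    using \<gamma> by (rule chart_at)
  show "smooth_on (h ` (U \<inter> {x \<in> carrier G. \<gamma> \<otimes> x \<in> W})) ((\<lambda>x. f (\<gamma> \<otimes> x)) \<circ> inv_into U h)"
  proof (rule smooth_on_local; clarify)
    fix x assume x: "x \<in> U" "x \<in> carrier G" "\<gamma> \<otimes> x \<in> W"
    obtain V k where V: "(V, k) \<in> A" "\<gamma> \<otimes> x \<in> V"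
      using chart_at[of "\<gamma> \<otimes> x"] \<gamma> x by blast
    have VW: "openin (atlas_topology A) (V \<inter> W)"
      using openin_chart_domain[OF V(1)] W by blast
    let ?T = "h ` (U \<inter> {x \<in> carrier G. \<gamma> \<otimes> x \<in> V \<inter> W})"
    have "open ?T"
      using A.open_chart_image[OF openin_translate[OF \<gamma> VW] c] .
    let ?P = "map_prod l h ` {z \<in> Z \<times> U. (case z of (x, y) \<Rightarrow> x \<otimes> y) \<in> V}"
    have ZU: "(Z \<times> U, map_prod l h) \<in> prod_atlas A A"
      using Z(1) c by (auto simp: prod_atlas_def)
    have Z_sub: "Z \<subseteq> carrier G" "U \<subseteq> carrier G"
      using open_subset_carrier openin_chart_domain Z(1) c by blast+
    have "{z \<in> Z \<times> U. (case z of (x, y) \<Rightarrow> x \<otimes> y) \<in> V} =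
        {z \<in> carrier G \<times> carrier G. fst z \<otimes> snd z \<in> V} \<inter> Z \<times> U"
      using Z_sub by auto
    then have "open ?P"
      using open_prod_chart[OF openin_mult_preimage[OF openin_chart_domain[OF V(1)]] Z(1) c] by simp
    have inv: "inv_into (Z \<times> U) (map_prod l h) (l \<gamma>, h y) = (\<gamma>, y)" if "y \<in> U" for y
      using inv_into_f_f[of "map_prod l h" "Z \<times> U" "(\<gamma>, y)"] that Z A.inj_chart[OF Z(1)]
        A.inj_chart[OF c] by (simp add: map_prod_inj_on)
    have mult: "smooth_on ?P (k \<circ> (\<lambda>(x, y). x \<otimes> y) \<circ> inv_into (Z \<times> U) (map_prod l h))"
      using lie_group ZU V(1) unfolding lie_group_def smooth_map_def by fast
    have pair: "smooth_on ?T (\<lambda>y. (l \<gamma>, y))"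
      unfolding smooth_on_def
      by (intro allI C_k_affine[where L = "\<lambda>v. (0, v)"]) (auto intro!: derivative_eq_intros)
    \<comment> \<open>The first coordinate is frozen at \<open>l \<gamma>\<close>. What remains is
      translation by \<gamma> read in the chart \<open>k\<close>, and composing with
      \<open>f\<close> in that chart removes \<open>k\<close> again.\<close>
    have "smooth_on ?T (\<lambda>y. (k \<circ> (\<lambda>(x, y). x \<otimes> y) \<circ> inv_into (Z \<times> U) (map_prod l h)) (l \<gamma>, y))"
      by (rule smooth_on_compose[OF \<open>open ?T\<close> \<open>open ?P\<close> _ pair mult]) (use Z in force)
    then have "smooth_on ?T (\<lambda>y. k (\<gamma> \<otimes> inv_into U h y))"
      by (rule smooth_on_cong[OF \<open>open ?T\<close>, rotated])
         (use inv A.inv_chart[OF c] in auto)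
    then have "smooth_on ?T (\<lambda>y. (f \<circ> inv_into V k) (k (\<gamma> \<otimes> inv_into U h y)))"
      by (rule smooth_on_compose[OF \<open>open ?T\<close> A.open_chart_image[OF W V(1)] _ _
            smooth_withinD[OF f V(1)], rotated])
         (use A.inv_chart[OF c] in auto)
    then have "smooth_on ?T ((\<lambda>x. f (\<gamma> \<otimes> x)) \<circ> inv_into U h)"
      by (rule smooth_on_cong[OF \<open>open ?T\<close>, rotated])
         (use A.inv_chart[OF c] A.inv_chart[OF V(1)] in auto)
    then show "\<exists>T. open T \<and> h x \<in> T \<and> smooth_on T ((\<lambda>x. f (\<gamma> \<otimes> x)) \<circ> inv_into U h)"
      using \<open>open ?T\<close> x V(2) by blast
  qed
qed

lemma smooth_near_translate:
  assumes "\<gamma> \<in> carrier G" "g \<in> carrier G" "f \<in> smooth_near A (\<gamma> \<otimes> g)"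
  shows "f \<circ> (\<lambda>x. \<gamma> \<otimes> x) \<in> smooth_near A g"
proof -
  obtain W where "\<gamma> \<otimes> g \<in> W" "openin (atlas_topology A) W" "smooth_within A W f"
    using assms(3) unfolding smooth_near_iff by blast
  then show ?thesis
    unfolding smooth_near_iff
    using assms openin_translate[of \<gamma> W] smooth_within_translate[of \<gamma> W f]
    by (intro exI[of _ "{x \<in> carrier G. \<gamma> \<otimes> x \<in> W}"]) (auto simp: o_def)
qed

section \<open>Fibres of the projection and local injectivity\<close>

lemma q_mult: "\<gamma> \<in> \<Gamma> \<Longrightarrow> x \<in> carrier G \<Longrightarrow> q (\<gamma> \<otimes> x) = q x"
  by (metis \<Gamma>_carrier coset_join2 coset_mult_assoc subgroup.subset subgroup_\<Gamma>)

lemma q_eqD: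
  assumes "q x = q y" "x \<in> carrier G" "y \<in> carrier G"
  obtains \<gamma> where "\<gamma> \<in> \<Gamma>" "y = \<gamma> \<otimes> x"
  using rcos_self[OF assms(3) subgroup_\<Gamma>] assms(1) by (auto simp: r_coset_def)

text \<open>If \<open>N\<close> is a neighbourhood of \<open>\<one>\<close> with \<open>N \<inter> \<Gamma> = {\<one>}\<close>, then \<open>q\<close> is injective on every
  \<open>W\<close> with \<open>W W\<^sup>-\<^sup>1 \<subseteq> N\<close>.\<close>
lemma locally_injective:
  assumes g: "g \<in> carrier G"
  obtains W where "openin (atlas_topology A) W" "g \<in> W" "inj_on q W"
proof -
  have "openin (subtopology (atlas_topology A) \<Gamma>) {\<one>}"
    using discrete subgroup.one_closed[OF subgroup_\<Gamma>] by (simp add: discrete_subgroup_def)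
  then obtain N where N: "openin (atlas_topology A) N" "N \<inter> \<Gamma> = {\<one>}"
    by (auto simp: openin_subtopology)
  have ig: "inv g \<in> carrier G" using g by simp
  obtain U h where U: "(U, h) \<in> A" "g \<in> U" using g by (rule chart_at)
  obtain V k where V: "(V, k) \<in> A" "inv g \<in> V" using ig by (rule chart_at)
  let ?M = "{z \<in> carrier G \<times> carrier G. fst z \<otimes> snd z \<in> N} \<inter> U \<times> V"
  have "open (map_prod h k ` ?M)"
    by (rule open_prod_chart[OF openin_mult_preimage[OF N(1)] U(1) V(1)])
  moreover have "(h g, k (inv g)) \<in> map_prod h k ` ?M"
  proof (rule rev_image_eqI)
    show "(g, inv g) \<in> ?M" using g N U V by auto
  qed simp
  \<comment> \<open>A box around the coordinates of \<open>(g, inv g)\<close>; its sides cut out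
    neighbourhoods of \<open>g\<close> and of \<open>inv g\<close> such that all products of their
    points lie in \<open>N\<close>.\<close>
  ultimately obtain S T where ST: "open S" "open T" "h g \<in> S" "k (inv g) \<in> T"
    "S \<times> T \<subseteq> map_prod h k ` ?M"
    by (rule open_prod_elim) (rule that, auto)
  let ?W1 = "{x \<in> U. h x \<in> S}" and ?W2 = "{x \<in> V. k x \<in> T}"
  let ?W = "?W1 \<inter> {x \<in> carrier G. inv x \<in> ?W2}"
  have W1: "openin (atlas_topology A) ?W1" and W2: "openin (atlas_topology A) ?W2"
    using openin_chart_preimage U(1) V(1) ST(1,2) by blast+
  have "continuous_map (atlas_topology A) (atlas_topology A) (\<lambda>x. inv x)"
    using lie_group by (simp add: lie_group_def smooth_map_def)
  then have W: "openin (atlas_topology A) ?W"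
    using openin_Int[OF W1 openin_continuous_map_preimage[OF _ W2]]
    by (simp add: A.topspace_atlas_topology points_A)
  have mult: "x \<otimes> y \<in> N" if "x \<in> ?W1" "y \<in> ?W2" for x y
  proof -
    have "(h x, k y) \<in> map_prod h k ` ?M"
      using that ST(5) by auto
    then obtain x' y' where "(x', y') \<in> ?M" "h x = h x'" "k y = k y'"
      by auto
    then show ?thesis
      using that inj_onD[OF A.inj_chart[OF U(1)]] inj_onD[OF A.inj_chart[OF V(1)]] by auto
  qed
  have "inj_on q ?W"
  proof (rule inj_onI)
    fix x y assume x: "x \<in> ?W" and y: "y \<in> ?W" and eq: "q x = q y"
    have c: "x \<in> carrier G" "y \<in> carrier G"
      using x y by auto
    obtain \<gamma> where \<gamma>: "\<gamma> \<in> \<Gamma>" "y = \<gamma> \<otimes> x"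
      using q_eqD[OF eq c] .
    have "y \<otimes> inv x \<in> N"
      using x y by (intro mult) auto
    moreover have "y \<otimes> inv x = \<gamma>"
      using \<gamma> c \<Gamma>_carrier by (simp add: m_assoc)
    ultimately have "\<gamma> = \<one>"
      using N(2) \<gamma>(1) by blast
    then show "x = y"
      using \<gamma>(2) c by simp
  qed
  then show thesis
    using that[OF W] U V ST g by auto
qed


section \<open>Charts and topology of the quotient\<close>

text \<open>The data from which \<open>quotient_atlas\<close> makes a chart. Injectivity of
  \<open>q\<close> means that distinct points of \<open>W\<close> lie in distinct
  \<Gamma>-orbits.\<close>

definition evenly_covered :: "'g set \<Rightarrow> 'g set \<Rightarrow> ('g \<Rightarrow> 'e) \<Rightarrow> bool" where
  "evenly_covered W U h \<longleftrightarrow>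
     (U, h) \<in> A \<and> W \<subseteq> U \<and> openin (atlas_topology A) W \<and> inj_on q W"

lemma evenly_coveredD:
  assumes "evenly_covered W U h"
  shows "(U, h) \<in> A" "W \<subseteq> U" "openin (atlas_topology A) W" "inj_on q W" "W \<subseteq> carrier G"
  using assms open_subset_carrier unfolding evenly_covered_def by blast+

lemma evenly_covered_at:
  assumes g: "g \<in> carrier G" obtains W U h where "evenly_covered W U h" "g \<in> W"
proof -
  obtain W where W: "openin (atlas_topology A) W" "g \<in> W" "inj_on q W"
    using g by (rule locally_injective)
  obtain U h where U: "(U, h) \<in> A" "g \<in> U"
    using g by (rule chart_at)
  have "evenly_covered (W \<inter> U) U h"
    using W U openin_chart_domain[OF U(1)] inj_on_subset[OF W(3)] by (auto simp: evenly_covered_def)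
  then show thesis
    using that W U by blast
qed

text \<open>Openness and smoothness on the group are tested in all charts; this replaces the chart
  carried by \<open>W\<close> by the one under test.\<close>

lemma evenly_covered_Int:
  "evenly_covered W U h \<Longrightarrow> (V, k) \<in> A \<Longrightarrow> evenly_covered (W \<inter> V) V k"
  using openin_chart_domain inj_on_subset[of q W] by (auto simp: evenly_covered_def)

definition quotient_chart :: "'g set \<Rightarrow> ('g \<Rightarrow> 'e) \<Rightarrow> 'g set \<Rightarrow> 'e" where
  "quotient_chart W h = h \<circ> inv_into W q"

lemma in_Q_iff:
  "(V, k) \<in> Q \<longleftrightarrow> (\<exists>W U h. evenly_covered W U h \<and> V = q ` W \<and> k = quotient_chart W h)"
  unfolding left_quotient_def quotient_atlas_def evenly_covered_def quotient_chart_def by blast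

lemma quotient_chart_q: "evenly_covered W U h \<Longrightarrow> w \<in> W \<Longrightarrow> quotient_chart W h (q w) = h w"
  by (simp add: quotient_chart_def evenly_coveredD(4))

lemma inj_on_quotient_chart: "evenly_covered W U h \<Longrightarrow> inj_on (quotient_chart W h) (q ` W)"
  by (rule inj_on_imageI, rule inj_on_cong[THEN iffD2, of _ _ h])
     (auto simp: quotient_chart_q
       intro: inj_on_subset[OF A.inj_chart[OF evenly_coveredD(1)] evenly_coveredD(2)])

lemma inv_quotient_chart:
  assumes "evenly_covered W U h" "w \<in> W"
  shows "inv_into (q ` W) (quotient_chart W h) (h w) = q w"
  using inv_into_f_f[OF inj_on_quotient_chart[OF assms(1)], of "q w"]
    quotient_chart_q[OF assms] assms(2) by simp

text \<open>Two orders of intersection, since \<open>smooth_near\<close> and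
  \<open>atlas_topology\<close> write theirs differently.\<close>

lemma quotient_chart_image:
  assumes "evenly_covered W U h"
  shows "quotient_chart W h ` (q ` W \<inter> V) = h ` {w \<in> W. q w \<in> V}"
    and "quotient_chart W h ` (V \<inter> q ` W) = h ` {w \<in> W. q w \<in> V}"
  using quotient_chart_q[OF assms] by (force simp: image_iff)+

lemma quotient_chart_range:
  assumes "evenly_covered W U h" shows "quotient_chart W h ` (q ` W) = h ` W"
  using quotient_chart_image(1)[OF assms, of UNIV] by simp

lemma open_image_evenly_covered:
  assumes "evenly_covered W U h" shows "open (h ` W)"
  using A.open_chart_image[OF evenly_coveredD(3,1)] assms evenly_coveredD(2)[OF assms]
  by (metis inf.absorb_iff2)

sublocale Q: open_atlas Q
proof
  fix V k assume "(V, k) \<in> Q"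
  then show "inj_on k V" "open (k ` V)"
    unfolding in_Q_iff
    using inj_on_quotient_chart quotient_chart_range open_image_evenly_covered by auto
qed

lemma points_Q: "points Q = q ` carrier G"
proof (intro equalityI subsetI)
  fix p assume "p \<in> points Q"
  then show "p \<in> q ` carrier G"
    unfolding points_def using in_Q_iff evenly_coveredD(5) by fastforce
next
  fix p assume "p \<in> q ` carrier G"
  then obtain g where g: "g \<in> carrier G" "p = q g" by blast
  then obtain W U h where "evenly_covered W U h" "g \<in> W"
    using evenly_covered_at by blast
  then have "(q ` W, quotient_chart W h) \<in> Q" "p \<in> q ` W"
    using in_Q_iff g by blast+
  then show "p \<in> points Q"
    unfolding points_def by blast
qed

lemma openin_Q_iff:
  "openin (atlas_topology Q) V \<longleftrightarrow> V \<subseteq> q ` carrier G \<and>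
    (\<forall>W U h. evenly_covered W U h \<longrightarrow> open (h ` {w \<in> W. q w \<in> V}))"
proof -
  have "(\<forall>(W, k)\<in>Q. open (k ` (V \<inter> W))) \<longleftrightarrow>
      (\<forall>W U h. evenly_covered W U h \<longrightarrow> open (quotient_chart W h ` (V \<inter> q ` W)))"
    by (fastforce simp: in_Q_iff)
  then show ?thesis
    by (simp add: Q.openin_atlas_topology points_Q quotient_chart_image(2))
qed

lemma openin_QD:
  "openin (atlas_topology Q) V \<Longrightarrow> evenly_covered W U h \<Longrightarrow> open (h ` {w \<in> W. q w \<in> V})"
  unfolding openin_Q_iff by blast

text \<open>The saturation of \<open>V\<close> is the union over \<gamma> in \<Gamma> of the
  preimages of \<open>V\<close> under translation by \<gamma>, hence open; a chart of the quotient
  sees its trace on \<open>W\<close>.\<close>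

lemma openin_q_image:
  assumes V: "openin (atlas_topology A) V"
  shows "openin (atlas_topology Q) (q ` V)"
  unfolding openin_Q_iff
proof (intro conjI allI impI)
  fix W U h assume W: "evenly_covered W U h"
  note sub = evenly_coveredD(5)[OF W] open_subset_carrier[OF V]
  have "{w \<in> W. q w \<in> q ` V} = (\<Union>\<gamma>\<in>\<Gamma>. {x \<in> carrier G. \<gamma> \<otimes> x \<in> V}) \<inter> W"
  proof (intro equalityI subsetI)
    fix w assume "w \<in> {w \<in> W. q w \<in> q ` V}"
    then obtain v where v: "w \<in> W" "v \<in> V" "q w = q v" by blast
    then obtain \<gamma> where "\<gamma> \<in> \<Gamma>" "v = \<gamma> \<otimes> w"
      using q_eqD[of w v] sub by blast
    then show "w \<in> (\<Union>\<gamma>\<in>\<Gamma>. {x \<in> carrier G. \<gamma> \<otimes> x \<in> V}) \<inter> W"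
      using v sub by blast
  next
    fix w assume "w \<in> (\<Union>\<gamma>\<in>\<Gamma>. {x \<in> carrier G. \<gamma> \<otimes> x \<in> V}) \<inter> W"
    then obtain \<gamma> where "\<gamma> \<in> \<Gamma>" "\<gamma> \<otimes> w \<in> V" "w \<in> W" "w \<in> carrier G" by blast
    then show "w \<in> {w \<in> W. q w \<in> q ` V}"
      using q_mult[of \<gamma> w] by (auto intro: rev_image_eqI[of "\<gamma> \<otimes> w"])
  qed
  moreover have "openin (atlas_topology A) (\<Union>\<gamma>\<in>\<Gamma>. {x \<in> carrier G. \<gamma> \<otimes> x \<in> V})"
    using openin_translate[OF \<Gamma>_carrier V] by blast
  ultimately have "openin (atlas_topology A) {w \<in> W. q w \<in> q ` V}"
    using evenly_coveredD(3)[OF W] by auto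
  then show "open (h ` {w \<in> W. q w \<in> q ` V})"
    using A.open_chart_image[OF _ evenly_coveredD(1)[OF W]] Int_absorb1[of "{w \<in> W. q w \<in> q ` V}" U]
      evenly_coveredD(2)[OF W] by (metis (no_types, lifting) mem_Collect_eq subset_iff)
qed (use open_subset_carrier[OF V] in auto)

lemma openin_q_preimage:
  assumes W: "evenly_covered W U h" and V: "openin (atlas_topology Q) V"
  shows "openin (atlas_topology A) {w \<in> W. q w \<in> V}"
  unfolding A.openin_atlas_topology points_A
proof (intro conjI; clarify?)
  fix U' h' assume "(U', h') \<in> A"
  then have "open (h' ` {w \<in> W \<inter> U'. q w \<in> V})"
    by (rule openin_QD[OF V evenly_covered_Int[OF W]])
  moreover have "{w \<in> W. q w \<in> V} \<inter> U' = {w \<in> W \<inter> U'. q w \<in> V}"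
    by auto
  ultimately show "open (h' ` ({w \<in> W. q w \<in> V} \<inter> U'))"
    by simp
qed (use evenly_coveredD(5)[OF W] in auto)

section \<open>Smooth functions and tangent vectors along the projection\<close>

text \<open>For each chart \<open>h'\<close> of the group, \<open>f \<circ> q\<close> has in
  \<open>h'\<close> the same coordinate expression as \<open>f\<close> in the quotient chart made
  from \<open>h'\<close> on \<open>W \<inter> U'\<close>.\<close>

lemma smooth_near_q:
  assumes g: "g \<in> carrier G" and f: "f \<in> smooth_near Q (q g)"
  shows "f \<circ> q \<in> smooth_near A g"
proof -
  obtain V where V: "q g \<in> V" "openin (atlas_topology Q) V" "smooth_within Q V f"
    using f unfolding smooth_near_iff by blast
  obtain W U h where W: "evenly_covered W U h" "g \<in> W"
    using g by (rule evenly_covered_at)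
  let ?N = "{w \<in> W. q w \<in> V}"
  have "smooth_within A ?N (f \<circ> q)"
    unfolding smooth_within_def
  proof clarify
    fix U' h' assume c: "(U', h') \<in> A"
    note W' = evenly_covered_Int[OF W(1) c]
    have "(q ` (W \<inter> U'), quotient_chart (W \<inter> U') h') \<in> Q"
      using W' in_Q_iff by blast
    from smooth_withinD[OF V(3) this]
    have *: "smooth_on (h' ` {w \<in> W \<inter> U'. q w \<in> V})
        (f \<circ> inv_into (q ` (W \<inter> U')) (quotient_chart (W \<inter> U') h'))"
      by (simp only: quotient_chart_image(1)[OF W'])
    have "open (h' ` {w \<in> W \<inter> U'. q w \<in> V})"
      by (rule openin_QD[OF V(2) W'])
    then have "smooth_on (h' ` {w \<in> W \<inter> U'. q w \<in> V}) (f \<circ> q \<circ> inv_into U' h')"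
      by (rule smooth_on_cong[OF _ _ *])
         (use inv_quotient_chart[OF W'] A.inv_chart[OF c] in auto)
    moreover have "U' \<inter> ?N = {w \<in> W \<inter> U'. q w \<in> V}"
      by auto
    ultimately show "smooth_on (h' ` (U' \<inter> ?N)) (f \<circ> q \<circ> inv_into U' h')"
      by simp
  qed
  then show ?thesis
    unfolding smooth_near_iff using openin_q_preimage[OF W(1) V(2)] W(2) V(1)
    by (intro exI[of _ ?N]) auto
qed

text \<open>A quotient chart may come from a set \<open>W'\<close> far from \<open>W\<close>. A
  common point of their images has lifts x in \<open>W'\<close> and y = \<gamma> x in
  \<open>W\<close>, and near x the function reads as \<open>f\<close> after translation by \<gamma>.
  This is where smoothness of left translations is used.\<close>

lemma smooth_near_section:
  assumes W: "evenly_covered W U h" "g \<in> W" and f: "f \<in> smooth_near A g"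
  shows "f \<circ> inv_into W q \<in> smooth_near Q (q g)"
proof -
  obtain V where V: "g \<in> V" "openin (atlas_topology A) V" "smooth_within A V f"
    using f unfolding smooth_near_iff by blast
  let ?N = "W \<inter> V"
  have N: "openin (atlas_topology A) ?N"
    using V(2) evenly_coveredD(3)[OF W(1)] by blast
  have "smooth_within Q (q ` ?N) (f \<circ> inv_into W q)"
    unfolding smooth_within_def
  proof clarify
    fix S k assume "(S, k) \<in> Q"
    then obtain W' U' h' where W': "evenly_covered W' U' h'" "S = q ` W'" "k = quotient_chart W' h'"
      unfolding in_Q_iff by blast
    note c = evenly_coveredD(1)[OF W'(1)] and sub = evenly_coveredD(2,5)[OF W'(1)]
    have "smooth_on (h' ` {w \<in> W'. q w \<in> q ` ?N})
        (f \<circ> inv_into W q \<circ> inv_into (q ` W') (quotient_chart W' h'))"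
    proof (rule smooth_on_local; clarify)
      fix x y assume x: "x \<in> W'" and y: "y \<in> W" "y \<in> V" and eq: "q x = q y"
      then obtain \<gamma> where \<gamma>: "\<gamma> \<in> \<Gamma>" "y = \<gamma> \<otimes> x"
        using q_eqD[OF eq] sub evenly_coveredD(5)[OF W(1)] by blast
      note \<gamma>' = \<Gamma>_carrier[OF \<gamma>(1)]
      \<comment> \<open>On this neighbourhood of \<open>x\<close> the same \<gamma> leads into
        \<open>W \<inter> V\<close>, so there the section is translation by \<gamma>.\<close>
      let ?T = "W' \<inter> {x \<in> carrier G. \<gamma> \<otimes> x \<in> ?N}"
      have T: "openin (atlas_topology A) ?T"
        using evenly_coveredD(3)[OF W'(1)] openin_translate[OF \<gamma>' N] by blast
      have o: "open (h' ` (U' \<inter> ?T))"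
        by (rule A.open_chart_image[OF T c])
      have "smooth_within A ?T (\<lambda>x. f (\<gamma> \<otimes> x))"
        by (rule smooth_within_subset[OF smooth_within_translate[OF \<gamma>' V(2,3)]]) auto
      note f\<gamma> = smooth_withinD[OF this c]
      have "smooth_on (h' ` (U' \<inter> ?T))
          (f \<circ> inv_into W q \<circ> inv_into (q ` W') (quotient_chart W' h'))"
      proof (rule smooth_on_cong[OF o _ f\<gamma>], clarify)
        fix z assume z: "z \<in> U'" "z \<in> W'" "z \<in> carrier G" "\<gamma> \<otimes> z \<in> W" "\<gamma> \<otimes> z \<in> V"
        have "inv_into W q (q z) = \<gamma> \<otimes> z"
          using inv_into_f_f[OF evenly_coveredD(4)[OF W(1)] z(4)] q_mult[OF \<gamma>(1) z(3)] by simp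
        then show "((\<lambda>x. f (\<gamma> \<otimes> x)) \<circ> inv_into U' h') (h' z) =
            (f \<circ> inv_into W q \<circ> inv_into (q ` W') (quotient_chart W' h')) (h' z)"
          using inv_quotient_chart[OF W'(1) z(2)] A.inv_chart[OF c z(1)] by simp
      qed
      moreover have "h' x \<in> h' ` (U' \<inter> ?T)"
      proof (rule imageI, intro IntI)
        show "x \<in> {x \<in> carrier G. \<gamma> \<otimes> x \<in> W \<inter> V}"
          using x y \<gamma>(2) sub(2) by blast
      qed (use x sub(1) in blast)+
      ultimately show "\<exists>T. open T \<and> h' x \<in> T \<and>
          smooth_on T (f \<circ> inv_into W q \<circ> inv_into (q ` W') (quotient_chart W' h'))"
        using o by (intro exI[of _ "h' ` (U' \<inter> ?T)"]) simp
    qed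
    then show "smooth_on (k ` (S \<inter> q ` ?N)) (f \<circ> inv_into W q \<circ> inv_into S k)"
      using quotient_chart_image(1)[OF W'(1)] W'(2,3) by simp
  qed
  then show ?thesis
    unfolding smooth_near_iff using openin_q_image[OF N] W(2) V(1)
    by (intro exI[of _ "q ` ?N"] conjI imageI) simp_all
qed

text \<open>The lift of \<open>v\<close> is its push-forward along the local section
  \<open>inv_into W q\<close>.\<close>

lemma push_forward_q_surj:
  assumes g: "g \<in> carrier G" and v: "v \<in> tangent_space Q (q g)"
  obtains u where "u \<in> tangent_space A g" "push_forward A Q q g u = v"
proof -
  obtain W U h where W: "evenly_covered W U h" "g \<in> W"
    using g by (rule evenly_covered_at)
  let ?s = "inv_into W q"
  have s: "?s (q w) = w" if "w \<in> W" for w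
    using inv_into_f_f[OF evenly_coveredD(4)[OF W(1)] that] .
  have u: "push_forward Q A ?s (q g) v \<in> tangent_space A (?s (q g))"
    by (rule push_forward_tangent[OF A.open_atlas_axioms _ v])
       (use smooth_near_section[OF W] s[OF W(2)] in simp)
  have "push_forward A Q q g (push_forward Q A ?s (q g) v) f = v f" for f
  proof (cases "f \<in> smooth_near Q (q g)")
    case True
    then have "push_forward A Q q g (push_forward Q A ?s (q g) v) f = v (f \<circ> q \<circ> ?s)"
      using smooth_near_q[OF g True] s[OF W(2)] by (simp add: push_forward_def)
    \<comment> \<open>\<open>f \<circ> q \<circ> ?s\<close> is known to equal \<open>f\<close> only
      on the image of \<open>W\<close>, so locality of \<open>v\<close> is needed.\<close>
    also have "\<dots> = v f"
      by (rule Q.tangent_local[OF v _ openin_q_image[OF evenly_coveredD(3)[OF W(1)]],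
            symmetric, OF True]) (use W(2) s in auto)
    finally show ?thesis .
  next
    case False
    then show ?thesis
      using tangent_outside[OF v False] by (simp add: push_forward_def)
  qed
  then show thesis
    using that[of "push_forward Q A ?s (q g) v"] u s[OF W(2)] by auto
qed

lemma push_forward_translate:
  assumes \<gamma>: "\<gamma> \<in> \<Gamma>" and g: "g \<in> carrier G" and u: "u \<in> tangent_space A g"
  shows "push_forward A A (\<lambda>x. \<gamma> \<otimes> x) g u \<in> tangent_space A (\<gamma> \<otimes> g)"
    and "push_forward A Q q (\<gamma> \<otimes> g) (push_forward A A (\<lambda>x. \<gamma> \<otimes> x) g u) = push_forward A Q q g u"
proof -
  note \<gamma>' = \<Gamma>_carrier[OF \<gamma>]
  show "push_forward A A (\<lambda>x. \<gamma> \<otimes> x) g u \<in> tangent_space A (\<gamma> \<otimes> g)"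
    by (rule push_forward_tangent[OF A.open_atlas_axioms smooth_near_translate[OF \<gamma>' g] u])
  have eq: "q (\<gamma> \<otimes> g) = q g"
    by (rule q_mult[OF \<gamma> g])
  have "push_forward A Q q (\<gamma> \<otimes> g) (push_forward A A (\<lambda>x. \<gamma> \<otimes> x) g u) f = push_forward A Q q g u f" for f
  proof (cases "f \<in> smooth_near Q (q g)")
    case True
    then have "f \<circ> q \<in> smooth_near A (\<gamma> \<otimes> g)"
      using smooth_near_q[of "\<gamma> \<otimes> g" f] \<gamma>' g eq by simp
    then have "push_forward A Q q (\<gamma> \<otimes> g) (push_forward A A (\<lambda>x. \<gamma> \<otimes> x) g u) f =
        u (f \<circ> q \<circ> (\<lambda>x. \<gamma> \<otimes> x))"
      using True eq by (simp add: push_forward_def)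
    \<comment> \<open>Translation by \<gamma> leaves \<open>q\<close> unchanged on the carrier; off
      it nothing is known, so the two functions are compared on the open set of all points.\<close>
    also have "\<dots> = u (f \<circ> q)"
      by (rule A.tangent_local[OF u smooth_near_q[OF g True] A.openin_points, symmetric])
         (use g q_mult[OF \<gamma>] points_A in auto)
    finally show ?thesis
      using True by (simp add: push_forward_def)
  qed (simp add: push_forward_def eq)
  then show "push_forward A Q q (\<gamma> \<otimes> g) (push_forward A A (\<lambda>x. \<gamma> \<otimes> x) g u) = push_forward A Q q g u"
    by blast
qed

text \<open>In the charts \<open>h\<close> and \<open>quotient_chart W h\<close> the projection is
  the identity of coordinates. On functions not smooth near \<open>q w\<close> both sides take the
  default value 0.\<close>

lemma push_forward_coord_vector:
  assumes W: "evenly_covered W U h" and w: "w \<in> W"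
  shows "push_forward A Q q w (coord_vector A U h b w) =
    coord_vector Q (q ` W) (quotient_chart W h) b (q w)"
proof
  fix f
  show "push_forward A Q q w (coord_vector A U h b w) f =
    coord_vector Q (q ` W) (quotient_chart W h) b (q w) f"
  proof (cases "f \<in> smooth_near Q (q w)")
    case True
    have g: "w \<in> carrier G"
      using evenly_coveredD(5)[OF W] w by blast
    have "frechet_derivative (f \<circ> q \<circ> inv_into U h) (at (h w)) =
        frechet_derivative (f \<circ> inv_into (q ` W) (quotient_chart W h)) (at (h w))"
      by (rule frechet_derivative_cong_open[OF open_image_evenly_covered[OF W]])
         (use w inv_quotient_chart[OF W] A.inv_chart[OF evenly_coveredD(1)[OF W]]
            evenly_coveredD(2)[OF W] in auto)
    then show ?thesis
      using True smooth_near_q[OF g True] quotient_chart_q[OF W w]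
      by (simp add: push_forward_def coord_vector_def)
  qed (simp add: push_forward_def coord_vector_def)
qed

section \<open>Descent of functions and forms to the quotient\<close>

text \<open>Smoothness of \<open>f'\<close> is read off from \<open>f\<close> in matching charts, so
  \<open>f'\<close> may come from an arbitrary choice of orbit representatives.\<close>

lemma smooth_function_descend:
  assumes f: "smooth_function A f" and eq: "\<And>g. g \<in> carrier G \<Longrightarrow> f' (q g) = f g"
  shows "smooth_function Q f'"
  unfolding smooth_function_def
proof clarify
  fix V k assume "(V, k) \<in> Q"
  then obtain W U h where W: "evenly_covered W U h" "V = q ` W" "k = quotient_chart W h"
    unfolding in_Q_iff by blast
  have "smooth_on (h ` U) (f \<circ> inv_into U h)"
    using f evenly_coveredD(1)[OF W(1)] unfolding smooth_function_def by blast
  then have "smooth_on (h ` W) (f \<circ> inv_into U h)"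
    by (rule smooth_on_subset) (use evenly_coveredD(2)[OF W(1)] in auto)
  then have "smooth_on (h ` W) (f' \<circ> inv_into V k)"
    by (rule smooth_on_cong[OF open_image_evenly_covered[OF W(1)], rotated])
       (use inv_quotient_chart[OF W(1)] A.inv_chart[OF evenly_coveredD(1)[OF W(1)]]
         evenly_coveredD(2,5)[OF W(1)] W(2,3) eq[symmetric] in \<open>auto simp: subset_iff\<close>)
  then show "smooth_on (k ` V) (f' \<circ> inv_into V k)"
    using quotient_chart_range[OF W(1)] W(2,3) by simp
qed

text \<open>In matching charts \<phi> and \<phi>' have equal components on the open set
  \<open>h\<close> followed by the coordinate vectors corresponding under the projection; the two
  coordinate formulas for the exterior derivative therefore coincide.\<close>

lemma has_exterior_derivative_descend:
  assumes \<phi>: "form1_eq A \<phi> (pullback A Q q \<phi>')"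
    and d: "has_exterior_derivative A \<phi>
      (\<lambda>g u v. \<eta> (q g) (push_forward A Q q g u) (push_forward A Q q g v))"
  shows "has_exterior_derivative Q \<phi>' \<eta>"
  unfolding has_exterior_derivative_def
proof clarify
  fix V k p and a b :: 'e
  assume "(V, k) \<in> Q" and p: "p \<in> V" and a: "a \<in> Basis" and b: "b \<in> Basis"
  then obtain W U h where W: "evenly_covered W U h" "V = q ` W" "k = quotient_chart W h"
    unfolding in_Q_iff by blast
  note c = evenly_coveredD(1)[OF W(1)] and sub = evenly_coveredD(2,5)[OF W(1)]
  obtain w where w: "w \<in> W" "p = q w"
    using p W(2) by blast
  have kp: "k p = h w"
    using quotient_chart_q[OF W(1) w(1)] w(2) W(3) by simp
  have "form_component Q V k \<phi>' i (h u) = form_component A U h \<phi> i (h u)" if u: "u \<in> W" for i u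
  proof -
    have "u \<in> U" "u \<in> points A"
      using u sub points_A by auto
    then have "\<phi> u (coord_vector A U h i u) = pullback A Q q \<phi>' u (coord_vector A U h i u)"
      using \<phi> A.coord_vector_tangent[OF c] unfolding form1_eq_def by blast
    then show ?thesis
      using push_forward_coord_vector[OF W(1) u] inv_quotient_chart[OF W(1) u]
        A.inv_chart[OF c \<open>u \<in> U\<close>] W(2,3) by (simp add: form_component_def pullback_def)
  qed
  then have "frechet_derivative (form_component Q V k \<phi>' i) (at (h w)) =
      frechet_derivative (form_component A U h \<phi> i) (at (h w))" for i
    by (intro frechet_derivative_cong_open[OF open_image_evenly_covered[OF W(1)]]) (use w in auto)
  moreover have "frechet_derivative (form_component A U h \<phi> b) (at (h w)) a
      - frechet_derivative (form_component A U h \<phi> a) (at (h w)) b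
      = \<eta> (q w) (push_forward A Q q w (coord_vector A U h a w))
          (push_forward A Q q w (coord_vector A U h b w))"
    using d c w(1) sub a b unfolding has_exterior_derivative_def by fast
  ultimately show "frechet_derivative (form_component Q V k \<phi>' b) (at (k p)) a
      - frechet_derivative (form_component Q V k \<phi>' a) (at (k p)) b
      = \<eta> p (coord_vector Q V k a p) (coord_vector Q V k b p)"
    using push_forward_coord_vector[OF W(1) w(1)] kp w(2) W(2,3) by simp
qed

end

section \<open>Invariance of the coefficients and the coframe on the quotient\<close>

theorem proposition5p2:
  fixes G :: "'g monoid"
    and A :: "('g, real ^ 3) atlas"
    and \<Gamma> :: "'g set"
    and Q :: "('g set, real ^ 3) atlas"
    and \<pi> :: "'g \<Rightarrow> 'g set"
    and \<K> :: "'g set \<Rightarrow> real"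
    and \<alpha>1 \<alpha>2 \<alpha>3 :: "'g set form1"
    and \<phi> :: "'g form1"
    and I J :: "'g \<Rightarrow> real"
  assumes G_lie: "lie_group G A"
    and G_cases: "lie_group_isomorphic G A SU2 SU2_atlas
          \<or> universal_cover G A E2 E2_atlas
          \<or> universal_cover G A PSL2 PSL2_atlas"
    and \<Gamma>_discrete: "discrete_subgroup \<Gamma> G A"
    and Q_eq: "Q = left_quotient G A \<Gamma>"
    and \<pi>_eq: "\<pi> = (\<lambda>g. \<Gamma> #>\<^bsub>G\<^esub> g)"
    and cartan: "cartan_structure Q \<K> \<alpha>1 \<alpha>2 \<alpha>3"
    and I_smooth: "smooth_function A I"
    and J_smooth: "smooth_function A J"
    and \<phi>_form: "smooth_form1 A \<phi>"
    and \<phi>_eq: "form1_eq A \<phi>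
          (\<lambda>g v. I g * pullback A Q \<pi> \<alpha>1 g v + J g * pullback A Q \<pi> \<alpha>2 g v)"
    and \<phi>_invariant: "\<forall>\<gamma>\<in>\<Gamma>. form1_eq A (pullback A A (\<lambda>g. \<gamma> \<otimes>\<^bsub>G\<^esub> g) \<phi>) \<phi>"
    and d\<phi>: "has_exterior_derivative A \<phi>
          (\<lambda>g u v. (\<K> (\<pi> g) - 1) * wedge (pullback A Q \<pi> \<alpha>1) (pullback A Q \<pi> \<alpha>2) g u v)"
    and I_nonconst: "\<not> (\<exists>c. \<forall>g\<in>carrier G. I g = c)"
    and J_nonconst: "\<not> (\<exists>c. \<forall>g\<in>carrier G. J g = c)"
  shows "\<exists>I' J' \<phi>'.
      (\<forall>g\<in>carrier G. I' (\<pi> g) = I g) \<and>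
      (\<forall>g\<in>carrier G. J' (\<pi> g) = J g) \<and>
      smooth_form1 Q \<phi>' \<and> form1_eq A (pullback A Q \<pi> \<phi>') \<phi> \<and>
      generalized_finsler Q I' J' \<alpha>1 (\<lambda>p v. \<phi>' p v - \<alpha>3 p v) \<alpha>2"
proof -
  interpret lie_group_quotient G A \<Gamma>
    using G_lie \<Gamma>_discrete by unfold_locales
  have smooth: "smooth_form1 Q \<alpha>1" "smooth_form1 Q \<alpha>2"
    and indep: "\<And>p a b c. p \<in> points Q \<Longrightarrow>
      \<forall>v\<in>tangent_space Q p. a * \<alpha>1 p v + b * \<alpha>2 p v + c * \<alpha>3 p v = 0 \<Longrightarrow> a = 0 \<and> b = 0 \<and> c = 0"
    using cartan unfolding cartan_structure_def coframe_def by blast+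
  have \<phi>: "\<phi> g u = I g * \<alpha>1 (\<pi> g) (push_forward A Q \<pi> g u) + J g * \<alpha>2 (\<pi> g) (push_forward A Q \<pi> g u)"
    if "g \<in> carrier G" "u \<in> tangent_space A g" for g u
    using \<phi>_eq that unfolding form1_eq_def pullback_def points_A by blast
  have inv: "I (\<gamma> \<otimes>\<^bsub>G\<^esub> g) = I g \<and> J (\<gamma> \<otimes>\<^bsub>G\<^esub> g) = J g" if \<gamma>: "\<gamma> \<in> \<Gamma>" and g: "g \<in> carrier G" for \<gamma> g
  proof -
    have \<gamma>g: "\<gamma> \<otimes>\<^bsub>G\<^esub> g \<in> carrier G"
      using \<Gamma>_carrier[OF \<gamma>] g by simp
    have "\<forall>v\<in>tangent_space Q (\<pi> g). (I (\<gamma> \<otimes>\<^bsub>G\<^esub> g) - I g) * \<alpha>1 (\<pi> g) v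
        + (J (\<gamma> \<otimes>\<^bsub>G\<^esub> g) - J g) * \<alpha>2 (\<pi> g) v + 0 * \<alpha>3 (\<pi> g) v = 0"
    proof
      fix v assume "v \<in> tangent_space Q (\<pi> g)"
      then obtain u where u: "u \<in> tangent_space A g" "push_forward A Q \<pi> g u = v"
        using push_forward_q_surj[OF g] unfolding Q_eq \<pi>_eq by blast
      \<comment> \<open>\<open>u\<close> and \<open>?u\<close> both project to \<open>v\<close>, so
        \<alpha>1 and \<alpha>2 take the same values on both sides of the invariance equation and
        only the coefficients can differ.\<close>
      let ?u = "push_forward A A (\<lambda>x. \<gamma> \<otimes>\<^bsub>G\<^esub> x) g u"
      have "\<phi> (\<gamma> \<otimes>\<^bsub>G\<^esub> g) ?u = \<phi> g u"
        using \<phi>_invariant \<gamma> g u(1) unfolding form1_eq_def pullback_def points_A by blast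
      moreover have "push_forward A Q \<pi> (\<gamma> \<otimes>\<^bsub>G\<^esub> g) ?u = v"
        using push_forward_translate(2)[OF \<gamma> g u(1)] u(2) unfolding Q_eq \<pi>_eq by simp
      moreover have "\<pi> (\<gamma> \<otimes>\<^bsub>G\<^esub> g) = \<pi> g"
        using q_mult[OF \<gamma> g] unfolding \<pi>_eq .
      ultimately show "(I (\<gamma> \<otimes>\<^bsub>G\<^esub> g) - I g) * \<alpha>1 (\<pi> g) v
          + (J (\<gamma> \<otimes>\<^bsub>G\<^esub> g) - J g) * \<alpha>2 (\<pi> g) v + 0 * \<alpha>3 (\<pi> g) v = 0"
        using \<phi>[OF \<gamma>g push_forward_translate(1)[OF \<gamma> g u(1)]] \<phi>[OF g u(1)] u(2)
        by (simp add: algebra_simps)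
    qed
    from indep[OF _ this] show ?thesis
      using points_Q g unfolding Q_eq \<pi>_eq by simp
  qed
  \<comment> \<open>A global choice of representatives, with no continuity. Invariance makes
    \<open>I\<close> and \<open>J\<close> independent of the choice, and their smoothness is
    recovered chart by chart.\<close>
  let ?s = "inv_into (carrier G) \<pi>"
  have descend: "I (?s (\<pi> g)) = I g" "J (?s (\<pi> g)) = J g" if g: "g \<in> carrier G" for g
  proof -
    have "\<pi> g \<in> \<pi> ` carrier G"
      using g by blast
    then have s: "?s (\<pi> g) \<in> carrier G" "\<pi> (?s (\<pi> g)) = \<pi> g"
      by (rule inv_into_into, rule f_inv_into_f)
    then have "q g = q (?s (\<pi> g))"
      unfolding \<pi>_eq by simp
    then obtain \<gamma> where "\<gamma> \<in> \<Gamma>" "?s (\<pi> g) = \<gamma> \<otimes>\<^bsub>G\<^esub> g"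
      using q_eqD[OF _ g s(1)] by metis
    then show "I (?s (\<pi> g)) = I g" "J (?s (\<pi> g)) = J g"
      using inv[OF _ g] by auto
  qed
  define I' J' where "I' = I \<circ> ?s" and "J' = J \<circ> ?s"
  define \<phi>' where "\<phi>' = (\<lambda>p v. I' p * \<alpha>1 p v + J' p * \<alpha>2 p v)"
  have I': "I' (\<pi> g) = I g" and J': "J' (\<pi> g) = J g" if "g \<in> carrier G" for g
    using descend[OF that] by (simp_all add: I'_def J'_def)
  have smooth': "smooth_function Q I'" "smooth_function Q J'"
    unfolding Q_eq
    by (rule smooth_function_descend[OF I_smooth], use I' \<pi>_eq in simp,
        rule smooth_function_descend[OF J_smooth], use J' \<pi>_eq in simp)
  have atlas: "open_atlas Q"
    unfolding Q_eq by (rule Q.open_atlas_axioms)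
  have \<phi>'_smooth: "smooth_form1 Q \<phi>'"
    unfolding \<phi>'_def by (rule open_atlas.smooth_form1_lincomb[OF atlas smooth' smooth])
  have pull: "form1_eq A (pullback A Q \<pi> \<phi>') \<phi>"
    unfolding form1_eq_def pullback_def points_A by (auto simp: \<phi> \<phi>'_def I' J')
  have "has_exterior_derivative Q \<phi>' (\<lambda>p u v. (\<K> p - 1) * wedge \<alpha>1 \<alpha>2 p u v)"
    unfolding Q_eq
  proof (rule has_exterior_derivative_descend)
    show "form1_eq A \<phi> (pullback A (left_quotient G A \<Gamma>) q \<phi>')"
      using pull unfolding form1_eq_def Q_eq \<pi>_eq by simp
    \<comment> \<open>The wedge of the two pulled back forms unfolds to \<alpha>1 \<and> \<alpha>2
      evaluated on pushed forward vectors.\<close>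
    show "has_exterior_derivative A \<phi> (\<lambda>g u v. (\<K> (q g) - 1) *
        wedge \<alpha>1 \<alpha>2 (q g) (push_forward A (left_quotient G A \<Gamma>) q g u)
          (push_forward A (left_quotient G A \<Gamma>) q g v))"
      using d\<phi> unfolding wedge_def pullback_def Q_eq \<pi>_eq .
  qed
  then have "generalized_finsler Q I' J' \<alpha>1 (\<lambda>p v. \<phi>' p v - \<alpha>3 p v) \<alpha>2"
    by (rule generalized_finsler_of_cartan[OF atlas cartan smooth' \<phi>'_def])
  with I' J' \<phi>'_smooth pull show ?thesis by blast
qed

end
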